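(* Let $\tau,\sigma>0$ and let $a_i,b_i,c_i,d_i\in\mathbb{R}$ with $a_id_i-b_ic_i=1$ and $b_i>0$ for $i=1,2$. Put $\boldsymbol{\tau}=[-\tau,\tau]\times[-\tau,\tau]$ and $\tilde{\boldsymbol{\sigma}}=[-\sigma/b_1,\sigma/b_1]\times[-\sigma/b_2,\sigma/b_2]$. Let $\tilde{\mathscr{B}}_{\tilde{\boldsymbol{\sigma}}}$ be the set of $h\in L^2(\mathbb{R}^2;\mathbb{H})$ whose two-sided quaternionic Fourier transform vanishes outside $\tilde{\boldsymbol{\sigma}}$, and let $$\alpha_{\max}=\max_{\tilde f\in\tilde{\mathscr{B}}_{\tilde{\boldsymbol{\sigma}}}}\alpha_f,\qquad \alpha_f=\frac{\int_{\boldsymbol{\tau}}|\tilde f(x,y)|^2\,dx\,dy}{\int_{\mathbb{R}^2}|\tilde f(x,y)|^2\,dx\,dy},$$ the maximum being over nonzero $\tilde f$ (which may be normalized to unit energy). If the eigenvalues $\mu$ of the integral equation $$\int_{\boldsymbol{\tau}}\tilde f(s,t)\,\frac{\sin\sigma(x-s)}{\pi(x-s)}\,\frac{\sin\sigma(y-t)}{\pi(y-t)}\,ds\,dt=\mu\,\tilde f(x,y)$$ have a maximum $\mu_{\max}$, then $\alpha_{\max}=\mu_{\max}$, and the eigenfunction corresponding to $\mu_{\max}$ is the function for which $\alpha_{\max}$ is reached.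
   Context: $\mathbb{H}$ denotes the real quaternions with units $\mathbf{i},\mathbf{j},\mathbf{k}$, and $L^2(\mathbb{R}^2;\mathbb{H})$ is the space of square-integrable $\mathbb{H}$-valued functions. The two-sided quaternionic Fourier transform is $\mathcal{F}(h)(u,v)=\int_{\mathbb{R}^2}e^{-\mathbf{i}xu}h(x,y)e^{-\mathbf{j}yv}\,dx\,dy$ for $h\in L^1\cap L^2$, extended to $L^2$. The two-sided quaternionic linear canonical transform (QLCT) with real parameter matrices $A_i=\begin{pmatrix}a_i&b_i\\c_i&d_i\end{pmatrix}$, $\det A_i=1$, $b_i>0$, is $$\mathcal{L}(f)(u,v)=\int_{\mathbb{R}^2}K^{\mathbf{i}}_{A_1}(x,u)\,f(x,y)\,K^{\mathbf{j}}_{A_2}(y,v)\,dx\,dy,$$ where $K^{\mathbf{i}}_{A_1}(x,u)=\frac{1}{\sqrt{\mathbf{i}2\pi b_1}}e^{\mathbf{i}\left(\frac{a_1}{2b_1}x^2-\frac{1}{b_1}xu+\frac{d_1}{2b_1}u^2\right)}$ and $K^{\mathbf{j}}_{A_2}(y,v)=\frac{1}{\sqrt{\mathbf{j}2\pi b_2}}e^{\mathbf{j}\left(\frac{a_2}{2b_2}y^2-\frac{1}{b_2}yv+\frac{d_2}{2b_2}v^2\right)}$, for $f\in L^1\cap L^2(\mathbb{R}^2;\mathbb{H})$, extended to $L^2$. For $f\in L^2(\mathbb{R}^2;\mathbb{H})$ put $\tilde f(x,y)=e^{\mathbf{i}\frac{a_1}{2b_1}x^2}f(x,y)e^{\mathbf{j}\frac{a_2}{2b_2}y^2}$;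 since $|\tilde f|=|f|$, $\alpha_f$ is also the fraction of the energy of $f$ lying in $\boldsymbol{\tau}$. A signal $f$ is $\boldsymbol{\sigma}$-bandlimited for the QLCT if $\mathcal{L}(f)(u,v)=0$ for $(u,v)$ outside $\boldsymbol{\sigma}=[-\sigma,\sigma]\times[-\sigma,\sigma]$; in that case $\tilde f\in\tilde{\mathscr{B}}_{\tilde{\boldsymbol{\sigma}}}$. An eigenvalue of the integral equation is a number $\mu$ for which a nonzero $\mathbb{H}$-valued $\tilde f\in L^2(\mathbb{R}^2;\mathbb{H})$ (a corresponding eigenfunction) satisfies it for $(x,y)\in\mathbb{R}^2$. The kernel is understood by continuity at $x=s$ or $y=t$.
   Formalization: In the integral equation the kernel uses sin((σ/b₁)(x−s)) and sin((σ/b₂)(y−t)) instead of sin σ(x−s) and sin σ(y−t); as printed the claim fails for large b₁b₂, since μ_max would not depend on b₁, b₂ while α_max tends to 0. *)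

theory Defs
  imports "HOL-Analysis.Analysis"
begin

section \<open>Real quaternions\<close>

datatype quat = Quat (qre: real) (qi: real) (qj: real) (qk: real)

lemma quat_eqI: "qre x = qre y \<Longrightarrow> qi x = qi y \<Longrightarrow> qj x = qj y \<Longrightarrow> qk x = qk y \<Longrightarrow> x = y"
  by (cases x; cases y) simp

lemma quat_eq_iff: "x = y \<longleftrightarrow> qre x = qre y \<and> qi x = qi y \<and> qj x = qj y \<and> qk x = qk y"
  by (cases x; cases y) simp

instantiation quat :: ab_group_add
begin
definition "0 = Quat 0 0 0 0"
definition "x + y = Quat (qre x + qre y) (qi x + qi y) (qj x + qj y) (qk x + qk y)"
definition "- x = Quat (- qre x) (- qi x) (- qj x) (- qk x)"
definition "x - y = Quat (qre x - qre y) (qi x - qi y) (qj x - qj y) (qk x - qk y)"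
instance
  by intro_classes
    (rule quat_eqI; simp add: zero_quat_def plus_quat_def uminus_quat_def minus_quat_def)+
end

lemma quat_add_simps [simp]:
  "qre 0 = 0" "qi 0 = 0" "qj 0 = 0" "qk 0 = 0"
  "qre (x + y) = qre x + qre y" "qi (x + y) = qi x + qi y"
  "qj (x + y) = qj x + qj y" "qk (x + y) = qk x + qk y"
  "qre (- x) = - qre x" "qi (- x) = - qi x" "qj (- x) = - qj x" "qk (- x) = - qk x"
  "qre (x - y) = qre x - qre y" "qi (x - y) = qi x - qi y"
  "qj (x - y) = qj x - qj y" "qk (x - y) = qk x - qk y"
  by (simp_all add: zero_quat_def plus_quat_def uminus_quat_def minus_quat_def)

instantiation quat :: real_algebra_1
begin
definition "1 = Quat 1 0 0 0"
definition "x * y = Quat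
   (qre x * qre y - qi x * qi y - qj x * qj y - qk x * qk y)
   (qre x * qi y + qi x * qre y + qj x * qk y - qk x * qj y)
   (qre x * qj y - qi x * qk y + qj x * qre y + qk x * qi y)
   (qre x * qk y + qi x * qj y - qj x * qi y + qk x * qre y)"
definition "r *\<^sub>R x = Quat (r * qre x) (r * qi x) (r * qj x) (r * qk x)"
instance
proof
  fix x y z :: quat and r s :: real
  show "x * y * z = x * (y * z)"
    by (rule quat_eqI) (simp_all add: times_quat_def ring_distribs)
  show "(x + y) * z = x * z + y * z" "x * (y + z) = x * y + x * z"
    by (rule quat_eqI; simp add: times_quat_def ring_distribs)+
  show "1 * x = x" "x * 1 = x"
    by (rule quat_eqI; simp add: times_quat_def one_quat_def)+
  show "(0::quat) \<noteq> 1"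
    by (simp add: quat_eq_iff one_quat_def)
  show "r *\<^sub>R (x + y) = r *\<^sub>R x + r *\<^sub>R y" "(r + s) *\<^sub>R x = r *\<^sub>R x + s *\<^sub>R x"
    "r *\<^sub>R s *\<^sub>R x = (r * s) *\<^sub>R x" "1 *\<^sub>R x = x"
    by (rule quat_eqI; simp add: scaleR_quat_def ring_distribs)+
  show "r *\<^sub>R x * y = r *\<^sub>R (x * y)" "x * r *\<^sub>R y = r *\<^sub>R (x * y)"
    by (rule quat_eqI; simp add: scaleR_quat_def times_quat_def right_diff_distrib ring_distribs)+
qed
end

lemma quat_mult_simps [simp]:
  "qre 1 = 1" "qi 1 = 0" "qj 1 = 0" "qk 1 = 0"
  "qre (x * y) = qre x * qre y - qi x * qi y - qj x * qj y - qk x * qk y"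
  "qi (x * y) = qre x * qi y + qi x * qre y + qj x * qk y - qk x * qj y"
  "qj (x * y) = qre x * qj y - qi x * qk y + qj x * qre y + qk x * qi y"
  "qk (x * y) = qre x * qk y + qi x * qj y - qj x * qi y + qk x * qre y"
  "qre (r *\<^sub>R x) = r * qre x" "qi (r *\<^sub>R x) = r * qi x"
  "qj (r *\<^sub>R x) = r * qj x" "qk (r *\<^sub>R x) = r * qk x"
  by (simp_all add: one_quat_def times_quat_def scaleR_quat_def)

lemma quat_square_eq_0:
  fixes a b c d :: real
  shows "a * a + b * b + c * c + d * d = 0 \<longleftrightarrow> a = 0 \<and> b = 0 \<and> c = 0 \<and> d = 0"
proof -
  have "a * a + b * b + c * c + d * d = 0 \<longleftrightarrow> a * a = 0 \<and> b * b = 0 \<and> c * c = 0 \<and> d * d = 0"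
    using zero_le_square[of a] zero_le_square[of b] zero_le_square[of c] zero_le_square[of d]
    by linarith
  then show ?thesis by simp
qed

instantiation quat :: real_inner
begin
definition "inner x y = qre x * qre y + qi x * qi y + qj x * qj y + qk x * qk y"
definition "norm (x::quat) = sqrt (inner x x)"
definition "sgn (x::quat) = x /\<^sub>R norm x"
definition "dist (x::quat) y = norm (x - y)"
definition [code del]: "uniformity = (INF e\<in>{0 <..}. principal {(x::quat, y). dist x y < e})"
definition [code del]:
  "open (U :: quat set) \<longleftrightarrow> (\<forall>x\<in>U. eventually (\<lambda>(x', y). x' = x \<longrightarrow> y \<in> U) uniformity)"
instance
proof
  fix r :: real and x y z :: quat and U :: "quat set"
  show "dist x y = norm (x - y)" by (rule dist_quat_def)
  show "sgn x = x /\<^sub>R norm x" by (rule sgn_quat_def)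
  show "uniformity = (INF e\<in>{0 <..}. principal {(x::quat, y). dist x y < e})"
    by (rule uniformity_quat_def)
  show "open U \<longleftrightarrow> (\<forall>x\<in>U. eventually (\<lambda>(x', y). x' = x \<longrightarrow> y \<in> U) uniformity)"
    by (rule open_quat_def)
  show "inner x y = inner y x" by (simp add: inner_quat_def algebra_simps)
  show "inner (x + y) z = inner x z + inner y z" by (simp add: inner_quat_def algebra_simps)
  show "inner (r *\<^sub>R x) y = r * inner x y" by (simp add: inner_quat_def algebra_simps)
  show "0 \<le> inner x x" by (simp add: inner_quat_def)
  show "inner x x = 0 \<longleftrightarrow> x = 0" by (simp add: inner_quat_def quat_square_eq_0 quat_eq_iff)
  show "norm x = sqrt (inner x x)" by (rule norm_quat_def)
qed
end

definition quat_cnj :: "quat \<Rightarrow> quat" where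
  "quat_cnj x = Quat (qre x) (- qi x) (- qj x) (- qk x)"

lemma quat_mult_cnj: "x * quat_cnj x = inner x x *\<^sub>R 1" "quat_cnj x * x = inner x x *\<^sub>R 1"
  by (simp_all add: quat_eq_iff inner_quat_def quat_cnj_def)

lemma quat_cnj_mult: "quat_cnj (x * y) = quat_cnj y * quat_cnj x"
  by (simp add: quat_eq_iff quat_cnj_def algebra_simps)

lemma quat_inner_mult: "inner (x * y) (x * y) = inner x x * inner y (y::quat)"
proof -
  have "inner (x * y) (x * y) *\<^sub>R 1 = x * (y * quat_cnj y) * quat_cnj x"
    by (simp only: quat_mult_cnj(1)[symmetric] quat_cnj_mult mult.assoc)
  also have "\<dots> = (inner x x * inner y y) *\<^sub>R 1"
    by (simp only: quat_mult_cnj(1) mult_scaleR_left mult_scaleR_right mult_1_right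
        scaleR_scaleR mult.commute)
  finally show ?thesis
    by (metis quat_mult_simps(1) quat_mult_simps(9) mult_1_right)
qed

instantiation quat :: real_normed_div_algebra
begin
definition "inverse (x::quat) = quat_cnj x /\<^sub>R inner x x"
definition "x div (y::quat) = x * inverse y"
instance
proof
  fix x y :: quat
  show "norm (x * y) = norm x * norm y"
    by (simp add: norm_quat_def quat_inner_mult real_sqrt_mult)
  show "inverse 0 = (0::quat)" by (simp add: inverse_quat_def)
  show "x div y = x * inverse y" by (rule divide_quat_def)
  assume "x \<noteq> 0"
  then show "inverse x * x = 1" "x * inverse x = 1"
    by (simp_all add: inverse_quat_def quat_mult_cnj)
qed
end

instantiation quat :: euclidean_space
begin
definition "Basis = {Quat 1 0 0 0, Quat 0 1 0 0, Quat 0 0 1 0, Quat 0 0 0 1}"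
instance
proof
  fix u v x :: quat
  show "(Basis :: quat set) \<noteq> {}" "finite (Basis :: quat set)"
    by (simp_all add: Basis_quat_def)
  show "u \<in> Basis \<Longrightarrow> v \<in> Basis \<Longrightarrow> inner u v = (if u = v then 1 else 0)"
    by (simp add: Basis_quat_def inner_quat_def) (elim disjE; simp)
  show "(\<forall>u\<in>Basis. inner x u = 0) \<longleftrightarrow> x = 0"
    by (auto simp: Basis_quat_def inner_quat_def intro: quat_eqI)
qed
end

definition quat_i :: quat where "quat_i = Quat 0 1 0 0"
definition quat_j :: quat where "quat_j = Quat 0 0 1 0"


section \<open>The two-sided quaternionic Fourier transform\<close>

definition qL1 :: "(real \<times> real \<Rightarrow> quat) set" where
  "qL1 = {h. integrable lborel h}"

text \<open>Elements of \<open>qL2\<close> are functions; they stand for their classes modulo almost everywhere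
  equality, so properties of them are stated almost everywhere.\<close>

definition qL2 :: "(real \<times> real \<Rightarrow> quat) set" where
  "qL2 = {h. h \<in> borel_measurable lborel \<and> integrable lborel (\<lambda>p. (norm (h p))\<^sup>2)}"

definition qft_L1 :: "(real \<times> real \<Rightarrow> quat) \<Rightarrow> real \<times> real \<Rightarrow> quat" where
  "qft_L1 h = (\<lambda>(u, v). LINT (x, y)|lborel.
     exp (- (x * u) *\<^sub>R quat_i) * h (x, y) * exp (- (y * v) *\<^sub>R quat_j))"

text \<open>The extension by continuity to \<open>L\<^sup>2\<close>: the closure of the graph of \<open>qft_L1\<close> restricted to
  \<open>L\<^sup>1 \<inter> L\<^sup>2\<close>. By Plancherel every \<open>h \<in> qL2\<close> has such a \<open>g\<close>, unique up to a null set. The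
  distances are extended nonnegative integrals, because the Bochner integral of a
  non-integrable function is 0.\<close>

definition has_qft :: "(real \<times> real \<Rightarrow> quat) \<Rightarrow> (real \<times> real \<Rightarrow> quat) \<Rightarrow> bool" where
  "has_qft h g \<longleftrightarrow> h \<in> qL2 \<and> g \<in> qL2 \<and>
     (\<exists>H :: nat \<Rightarrow> real \<times> real \<Rightarrow> quat. (\<forall>n. H n \<in> qL1 \<inter> qL2) \<and>
        (\<lambda>n. \<integral>\<^sup>+ p. ennreal ((norm (H n p - h p))\<^sup>2) \<partial>lborel) \<longlonglongrightarrow> 0 \<and>
        (\<lambda>n. \<integral>\<^sup>+ p. ennreal ((norm (qft_L1 (H n) p - g p))\<^sup>2) \<partial>lborel) \<longlonglongrightarrow> 0)"


section \<open>Bandlimited signals and energy concentration\<close>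

definition rect :: "real \<Rightarrow> real \<Rightarrow> (real \<times> real) set" where
  "rect w1 w2 = {- w1..w1} \<times> {- w2..w2}"

definition bandlimited :: "(real \<times> real) set \<Rightarrow> (real \<times> real \<Rightarrow> quat) set" where
  "bandlimited W = {h. \<exists>g. has_qft h g \<and> (AE p in lborel. p \<notin> W \<longrightarrow> g p = 0)}"

definition nonzero :: "(real \<times> real \<Rightarrow> quat) \<Rightarrow> bool" where
  "nonzero f \<longleftrightarrow> \<not> (AE p in lborel. f p = 0)"

definition energy_ratio :: "(real \<times> real) set \<Rightarrow> (real \<times> real \<Rightarrow> quat) \<Rightarrow> real" where
  "energy_ratio T f = (LINT p:T|lborel. (norm (f p))\<^sup>2) / (LINT p|lborel. (norm (f p))\<^sup>2)"

text \<open>The kernel \<open>sin (w x) / (\<pi> x)\<close>, extended by continuity. It is the inverse Fourier transform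
  of the indicator of \<open>[-w, w]\<close>, so in the integral equation for signals bandlimited to
  \<open>rect w1 w2\<close> the parameters are the half-widths of that rectangle; for \<open>rect (\<sigma> / b1) (\<sigma> / b2)\<close>
  they are \<open>\<sigma> / b1\<close> and \<open>\<sigma> / b2\<close>, not \<open>\<sigma>\<close>. With \<open>\<sigma>\<close> in both variables the eigenvalues would not
  depend on \<open>b1\<close>, \<open>b2\<close>, whereas the maximal energy ratio tends to 0 as \<open>b1 * b2\<close> grows.\<close>

definition sinc_kernel :: "real \<Rightarrow> real \<Rightarrow> real" where
  "sinc_kernel w x = (if x = 0 then w / pi else sin (w * x) / (pi * x))"

definition eigenfunction ::
  "(real \<times> real) set \<Rightarrow> real \<Rightarrow> real \<Rightarrow> real \<Rightarrow> (real \<times> real \<Rightarrow> quat) \<Rightarrow> bool" where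
  "eigenfunction T w1 w2 \<mu> f \<longleftrightarrow> f \<in> qL2 \<and> nonzero f \<and>
     (AE (x, y) in lborel.
        (LINT (s, t):T|lborel. (sinc_kernel w1 (x - s) * sinc_kernel w2 (y - t)) *\<^sub>R f (s, t))
          = \<mu> *\<^sub>R f (x, y))"

definition eigenvalues :: "(real \<times> real) set \<Rightarrow> real \<Rightarrow> real \<Rightarrow> real set" where
  "eigenvalues T w1 w2 = {\<mu>. \<exists>f. eigenfunction T w1 w2 \<mu> f}"

definition is_maximum :: "real set \<Rightarrow> real \<Rightarrow> bool" where
  "is_maximum S m \<longleftrightarrow> m \<in> S \<and> (\<forall>x\<in>S. x \<le> m)"

end

theory Submission
  imports Defs "HOL-Complex_Analysis.Great_Picard" "HOL-Probability.Characteristic_Functions"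
begin

text \<open>
  Write \<open>F\<close> for the two-sided transform, \<open>T\<close> and \<open>W\<close> for the time and frequency rectangles, and \<open>K\<close>
  for convolution with the sinc kernel. Regularising with Gaussians gives Plancherel for
  \<open>F\<close> on \<open>L\<^sup>1 \<inter> L\<^sup>2\<close>, and Fubini gives \<open>F (K g) = 1_W F g\<close>; hence \<open>\<langle>K g, f\<rangle> = \<langle>g, f\<rangle>\<close> for
  bandlimited \<open>f\<close> and time-limited \<open>g\<close>. Let \<open>\<Lambda>\<close> be the supremum of
  \<open>\<langle>K g, g\<rangle> = \<parallel>K g\<parallel>\<^sup>2\<close> over unit \<open>g\<close> supported in \<open>T\<close>. For bandlimited \<open>f\<close> and \<open>g = 1_T f\<close>,
  \<open>\<parallel>K g - \<Lambda> f\<parallel>\<^sup>2 \<le> \<Lambda> (\<Lambda> \<parallel>f\<parallel>\<^sup>2 - \<parallel>g\<parallel>\<^sup>2)\<close>, so the energy ratio is at most \<open>\<Lambda>\<close>, with equality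
  only if \<open>K g = \<Lambda> f\<close>. Conversely an eigenfunction with eigenvalue \<open>\<mu> \<noteq> 0\<close> is bandlimited with energy
  ratio \<open>\<mu>\<close>. Finally \<open>\<Lambda>\<close> is positive and an eigenvalue, by the theorem of Arzela and Ascoli.
\<close>

subsection \<open>The quaternionic exponential kernel\<close>

text \<open>The transform multiplies by exponentials in \<open>quat_i\<close> on the left and in
  \<open>quat_j\<close> on the right, and quaternions do not commute, so the usual convolution
  theorem is not at hand. The proof therefore works with a real inner product, for which every
  kernel is an isometry with its inverse as adjoint, and it weights frequencies only by real even
  functions of product form. Against these the sine terms integrate to zero and a real scalar
  remains, which commutes with everything. Gaussian weights then yield Plancherel, and indicators of
  intervals yield the sinc kernel, by one and the same formula. The hypothesis is about eigenvalues,
  the conclusion about a maximum over signals. The eigenvalue 0 does not link the two, since every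
  nonzero square-integrable function that vanishes on the time rectangle belongs to it, bandlimited
  or not; and a supremum that is not attained could exceed all eigenvalues. Hence \<Lambda> has to
  be shown both positive and attained.\<close>

lemma exp_scaleR_unit:
  fixes e :: "'a :: {real_normed_algebra_1, banach}"
  assumes "e * e = - 1"
  shows "exp (t *\<^sub>R e) = cos t *\<^sub>R 1 + sin t *\<^sub>R e"
proof -
  \<comment> \<open>The second factor is the expected inverse of the exponential; the product has
    derivative zero and is therefore constantly 1.\<close>
  let ?g = "\<lambda>t. exp (t *\<^sub>R e) * (cos t *\<^sub>R 1 - sin t *\<^sub>R e)"
  have "(?g has_vector_derivative 0) (at t within UNIV)" for t
  proof -
    have "(?g has_vector_derivative
        (exp (t *\<^sub>R e) * ((- sin t) *\<^sub>R 1 - cos t *\<^sub>R e) + (exp (t *\<^sub>R e) * e) * (cos t *\<^sub>R 1 - sin t *\<^sub>R e))) (at t)"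
    proof (rule has_vector_derivative_mult[OF exp_scaleR_has_vector_derivative_right])
      show "((\<lambda>t. cos t *\<^sub>R 1 - sin t *\<^sub>R e) has_vector_derivative (- sin t) *\<^sub>R 1 - cos t *\<^sub>R e) (at t)"
        using has_vector_derivative_diff[OF
            has_vector_derivative_scaleR[OF DERIV_cos has_vector_derivative_const[of 1]]
            has_vector_derivative_scaleR[OF DERIV_sin has_vector_derivative_const[of e]]]
        by simp
    qed
    moreover have "exp (t *\<^sub>R e) * ((- sin t) *\<^sub>R 1 - cos t *\<^sub>R e) + (exp (t *\<^sub>R e) * e) * (cos t *\<^sub>R 1 - sin t *\<^sub>R e) = 0"
      by (simp add: right_diff_distrib mult.assoc assms)
    ultimately show ?thesis by simp
  qed
  then have D: "\<And>x. x \<in> UNIV \<Longrightarrow> (?g has_vector_derivative 0) (at x within UNIV)" by (simp only:)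
  obtain c where c: "\<And>x. x \<in> UNIV \<Longrightarrow> ?g x = c"
    by (rule has_vector_derivative_zero_constant[OF convex_UNIV D]) (simp_all only:)
  have "?g 0 = 1" by simp
  then have g1: "?g t = 1" using c[of 0] c[of t] by (simp only: UNIV_I simp_thms)
  have "(cos t *\<^sub>R 1 - sin t *\<^sub>R e) * (cos t *\<^sub>R 1 + sin t *\<^sub>R e)
      = (cos t * cos t) *\<^sub>R 1 + (sin t * sin t) *\<^sub>R 1"
    by (simp add: right_diff_distrib left_diff_distrib ring_distribs scaleR_right_diff_distrib
        scaleR_right_distrib assms mult.commute[of "sin t" "cos t"])
  also have "\<dots> = 1"
    by (simp flip: scaleR_add_left power2_eq_square)
  finally have "(cos t *\<^sub>R 1 - sin t *\<^sub>R e) * (cos t *\<^sub>R 1 + sin t *\<^sub>R e) = 1" .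
  then have "?g t * (cos t *\<^sub>R 1 + sin t *\<^sub>R e) = exp (t *\<^sub>R e)"
    by (simp only: mult.assoc mult_1_right)
  then show ?thesis by (simp only: g1 mult_1_left)
qed

lemma quat_i_squared: "quat_i * quat_i = - 1" and quat_j_squared: "quat_j * quat_j = - 1"
  by (simp_all add: quat_eq_iff quat_i_def quat_j_def)

text \<open>This is the integrand of the transform as a map of the value \<open>q\<close>. It is
  real linear, symmetric in \<open>p\<close> and \<open>w\<close>, and for fixed \<open>w\<close> a
  group action of the points \<open>p\<close>.\<close>

definition qrot :: "real \<times> real \<Rightarrow> real \<times> real \<Rightarrow> quat \<Rightarrow> quat" where
  "qrot p w q = exp (- (fst p * fst w) *\<^sub>R quat_i) * q * exp (- (snd p * snd w) *\<^sub>R quat_j)"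

lemma qrot_trig:
  "qrot (x, y) (u, v) q =
     (cos (x * u) * cos (y * v)) *\<^sub>R q - (sin (x * u) * cos (y * v)) *\<^sub>R (quat_i * q)
   - (cos (x * u) * sin (y * v)) *\<^sub>R (q * quat_j) + (sin (x * u) * sin (y * v)) *\<^sub>R (quat_i * q * quat_j)"
  unfolding qrot_def exp_scaleR_unit[OF quat_i_squared] exp_scaleR_unit[OF quat_j_squared]
  by (simp add: algebra_simps)

lemma qrot_commute: "qrot p w q = qrot w p q"
  by (simp add: qrot_def mult.commute)

lemma qrot_qrot: "qrot p w (qrot p' w q) = qrot (p + p') w q"
proof -
  have "qrot p w (qrot p' w q) =
    (exp (- (fst p * fst w) *\<^sub>R quat_i) * exp (- (fst p' * fst w) *\<^sub>R quat_i)) * q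
     * (exp (- (snd p' * snd w) *\<^sub>R quat_j) * exp (- (snd p * snd w) *\<^sub>R quat_j))"
    by (simp add: qrot_def mult.assoc)
  also have "\<dots> = qrot (p + p') w q"
    by (subst (1 2) exp_add_commuting[symmetric]) (simp_all add: qrot_def algebra_simps)
  finally show ?thesis .
qed

lemma qrot_0 [simp]: "qrot 0 w q = q"
  by (simp add: qrot_def)

lemma linear_qrot: "linear (qrot p w)"
  by (rule linearI) (simp_all add: qrot_def algebra_simps)

lemma norm_qrot [simp]: "norm (qrot p w q) = norm q"
proof -
  have "norm (exp (t *\<^sub>R quat_i)) = 1" "norm (exp (t *\<^sub>R quat_j)) = 1" for t
    unfolding exp_scaleR_unit[OF quat_i_squared] exp_scaleR_unit[OF quat_j_squared]
    by (simp_all add: norm_quat_def inner_quat_def quat_i_def quat_j_def flip: power2_eq_square)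
  then show ?thesis unfolding qrot_def norm_mult by (simp only: mult_1_left mult_1_right)
qed

lemma bounded_linear_qrot: "bounded_linear (qrot p w)"
  using linear_qrot linear_conv_bounded_linear by blast

text \<open>Polarization: a linear map that preserves the norm preserves the inner product.\<close>

lemma inner_qrot_qrot: "inner (qrot p w q) (qrot p w r) = inner q r"
proof -
  have *: "inner a b = ((norm (a + b))\<^sup>2 - (norm a)\<^sup>2 - (norm b)\<^sup>2) / 2" for a b :: quat
    by (rule dot_norm)
  show ?thesis
    by (subst (1 2) *) (simp flip: linear_add[OF linear_qrot])
qed

lemma inner_qrot: "inner (qrot p w q) r = inner q (qrot (- p) w r)"
  by (metis add.right_inverse inner_qrot_qrot qrot_0 qrot_qrot)

lemma measurable_qrot [measurable (raw)]:
  assumes [measurable]: "f \<in> borel_measurable M" "g \<in> borel_measurable M" "h \<in> borel_measurable M"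
  shows "(\<lambda>x. qrot (f x) (g x) (h x)) \<in> borel_measurable M"
proof -
  have "(\<lambda>(p, w, q). qrot p w q) \<in> borel_measurable borel"
    by (intro borel_measurable_continuous_onI)
      (auto simp: qrot_def split_beta exp_scaleR_unit quat_i_squared quat_j_squared
        simp flip: scaleR_minus_left intro!: continuous_intros)
  then have "(\<lambda>x. (\<lambda>(p, w, q). qrot p w q) (f x, g x, h x)) \<in> borel_measurable M"
    by (rule measurable_compose[rotated]) (intro borel_measurable_Pair assms)
  then show ?thesis by simp
qed

lemma qft_L1_eq: "qft_L1 h w = (LINT p|lborel. qrot p w (h p))"
  by (cases w) (simp add: qft_L1_def qrot_def case_prod_unfold)

subsection \<open>The real inner product on square-integrable functions\<close>

text \<open>A real pairing is enough because all eigenvalues are real and all operators are used as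
  real-linear maps; it also spares the choice between left and right scalars.\<close>

definition qip :: "(real \<times> real \<Rightarrow> quat) \<Rightarrow> (real \<times> real \<Rightarrow> quat) \<Rightarrow> real" where
  "qip f g = (LINT p|lborel. inner (f p) (g p))"

lemma qL2_measurable [measurable_dest]: "f \<in> qL2 \<Longrightarrow> f \<in> borel_measurable borel"
  by (simp add: qL2_def)

lemma qL2_integrable_square: "f \<in> qL2 \<Longrightarrow> integrable lborel (\<lambda>p. (norm (f p))\<^sup>2)"
  by (simp add: qL2_def)

lemma qL2I:
  assumes "f \<in> borel_measurable borel" "integrable lborel g" "\<And>p. (norm (f p))\<^sup>2 \<le> g p"
  shows "f \<in> qL2"
  unfolding qL2_def using assms(1)
  by (auto intro!: Bochner_Integration.integrable_bound[OF assms(2)] always_eventually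
      simp: order_trans[OF assms(3) abs_ge_self])

lemma qL2_integrable_norm_mult:
  assumes "f \<in> qL2" "g \<in> qL2"
  shows "integrable lborel (\<lambda>p. norm (f p) * norm (g p))"
proof (rule Bochner_Integration.integrable_bound)
  show "integrable lborel (\<lambda>p. (norm (f p))\<^sup>2 + (norm (g p))\<^sup>2)"
    using assms by (intro Bochner_Integration.integrable_add qL2_integrable_square)
  show "(\<lambda>p. norm (f p) * norm (g p)) \<in> borel_measurable lborel"
    using assms by measurable
  have "a * b \<le> a\<^sup>2 + b\<^sup>2" if "a \<ge> 0" "b \<ge> 0" for a b :: real
    using sum_squares_bound[of a b] that mult_nonneg_nonneg[of a b] by linarith
  then show "AE p in lborel. norm (norm (f p) * norm (g p)) \<le> norm ((norm (f p))\<^sup>2 + (norm (g p))\<^sup>2)"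
    by simp
qed

lemma qL2_integrable_inner:
  assumes "f \<in> qL2" "g \<in> qL2"
  shows "integrable lborel (\<lambda>p. inner (f p) (g p))"
proof (rule Bochner_Integration.integrable_bound[OF qL2_integrable_norm_mult[OF assms]])
  show "(\<lambda>p. inner (f p) (g p)) \<in> borel_measurable lborel"
    using assms by measurable
qed (simp add: Cauchy_Schwarz_ineq2)

lemma qL2_bounded_mult:
  assumes "f \<in> qL2" "m \<in> borel_measurable borel" "\<And>p. \<bar>m p\<bar> \<le> C"
  shows "(\<lambda>p. m p *\<^sub>R f p) \<in> qL2"
proof (rule qL2I)
  show "(\<lambda>p. m p *\<^sub>R f p) \<in> borel_measurable borel"
    using assms by measurable
  show "integrable lborel (\<lambda>p. C\<^sup>2 * (norm (f p))\<^sup>2)"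
    using assms(1) by (simp add: qL2_integrable_square)
  show "(norm (m p *\<^sub>R f p))\<^sup>2 \<le> C\<^sup>2 * (norm (f p))\<^sup>2" for p
    using abs_le_square_iff[of "m p" C] assms(3)[of p]
    by (simp add: power_mult_distrib mult_right_mono)
qed

lemma qL2_scaleR: "f \<in> qL2 \<Longrightarrow> (\<lambda>p. c *\<^sub>R f p) \<in> qL2"
  by (rule qL2_bounded_mult[of f "\<lambda>_. c" "\<bar>c\<bar>"]) auto

lemma qL2_indicator: "f \<in> qL2 \<Longrightarrow> A \<in> sets borel \<Longrightarrow> (\<lambda>p. indicator A p *\<^sub>R f p) \<in> qL2"
  by (rule qL2_bounded_mult[of f "indicator A" 1]) (auto simp: indicator_def)

lemma qL2_add:
  assumes "f \<in> qL2" "g \<in> qL2"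
  shows "(\<lambda>p. f p + g p) \<in> qL2"
proof (rule qL2I)
  show "integrable lborel (\<lambda>p. 2 * (norm (f p))\<^sup>2 + 2 * (norm (g p))\<^sup>2)"
    using assms by (simp add: qL2_integrable_square)
  fix p
  have "(norm (f p + g p))\<^sup>2 \<le> (norm (f p) + norm (g p))\<^sup>2"
    by (intro power_mono norm_triangle_ineq) auto
  also have "\<dots> \<le> 2 * (norm (f p))\<^sup>2 + 2 * (norm (g p))\<^sup>2"
    using sum_squares_bound[of "norm (f p)" "norm (g p)"] by (simp add: power2_sum)
  finally show "(norm (f p + g p))\<^sup>2 \<le> 2 * (norm (f p))\<^sup>2 + 2 * (norm (g p))\<^sup>2" .
qed (use assms in measurable)

lemma qL2_diff:
  assumes "f \<in> qL2" "g \<in> qL2"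
  shows "(\<lambda>p. f p - g p) \<in> qL2"
  using qL2_add[OF assms(1) qL2_scaleR[OF assms(2), of "-1"]] by simp

lemma qip_commute: "qip f g = qip g f"
  by (simp add: qip_def inner_commute)

lemma qip_self: "qip f f = (LINT p|lborel. (norm (f p))\<^sup>2)"
  by (simp add: qip_def power2_norm_eq_inner)

lemma qip_nonneg: "0 \<le> qip f f"
  by (simp add: qip_self)

lemma qip_add_left:
  "f \<in> qL2 \<Longrightarrow> g \<in> qL2 \<Longrightarrow> h \<in> qL2 \<Longrightarrow> qip (\<lambda>p. f p + g p) h = qip f h + qip g h"
  by (simp add: qip_def inner_add_left Bochner_Integration.integral_add qL2_integrable_inner)

lemma qip_scaleR_left: "qip (\<lambda>p. c *\<^sub>R f p) h = c * qip f h"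
  by (simp add: qip_def)

lemma qip_diff_left:
  "f \<in> qL2 \<Longrightarrow> g \<in> qL2 \<Longrightarrow> h \<in> qL2 \<Longrightarrow> qip (\<lambda>p. f p - g p) h = qip f h - qip g h"
  by (simp add: qip_def inner_diff_left Bochner_Integration.integral_diff qL2_integrable_inner)

lemma qip_add_right:
  "f \<in> qL2 \<Longrightarrow> g \<in> qL2 \<Longrightarrow> h \<in> qL2 \<Longrightarrow> qip h (\<lambda>p. f p + g p) = qip h f + qip h g"
  by (simp add: qip_add_left qip_commute[of h])

lemma qip_scaleR_right: "qip h (\<lambda>p. c *\<^sub>R f p) = c * qip h f"
  by (simp add: qip_def)

lemma qip_diff_right:
  "f \<in> qL2 \<Longrightarrow> g \<in> qL2 \<Longrightarrow> h \<in> qL2 \<Longrightarrow> qip h (\<lambda>p. f p - g p) = qip h f - qip h g"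
  by (simp add: qip_diff_left qip_commute[of h])

lemmas qip_simps = qip_add_left qip_add_right qip_diff_left qip_diff_right
  qip_scaleR_left qip_scaleR_right qL2_add qL2_diff qL2_scaleR

lemma qip_cong_AE:
  assumes "AE p in lborel. f p = f' p" "AE p in lborel. g p = g' p"
    and "f \<in> qL2" "f' \<in> qL2" "g \<in> qL2" "g' \<in> qL2"
  shows "qip f g = qip f' g'"
  unfolding qip_def
proof (rule integral_cong_AE)
  show "AE p in lborel. inner (f p) (g p) = inner (f' p) (g' p)"
    using assms(1,2) by eventually_elim simp
qed (use assms(3-6) in measurable)

lemma qip_self_eq_0_iff:
  assumes "f \<in> qL2"
  shows "qip f f = 0 \<longleftrightarrow> (AE p in lborel. f p = 0)"
  unfolding qip_self
  using integral_nonneg_eq_0_iff_AE[OF qL2_integrable_square[OF assms]] by simp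

text \<open>The core of Cauchy-Schwarz for a form that is only semidefinite. It serves both
  \<open>qip\<close> and, later, the form measuring the distance of \<open>conc\<close> from its
  upper bound.\<close>

lemma quadratic_nonneg_imp_discriminant:
  fixes A B C :: real
  assumes "\<And>t. 0 \<le> A + 2 * t * B + t\<^sup>2 * C" "0 \<le> C"
  shows "B\<^sup>2 \<le> A * C"
proof (cases "C = 0")
  case True
  have "B = 0"
  proof (rule ccontr)
    assume "B \<noteq> 0"
    \<comment> \<open>With \<open>C = 0\<close> the expression is affine in \<open>t\<close>; this
      \<open>t\<close> makes it negative.\<close>
    then have "2 * (- (\<bar>A\<bar> + 1) / B) * B = - 2 * (\<bar>A\<bar> + 1)" by simp
    then show False using assms(1)[of "- (\<bar>A\<bar> + 1) / B"] True by simp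
  qed
  with True show ?thesis by simp
next
  case False
  \<comment> \<open>The quadratic is evaluated at its minimizer \<open>- B / C\<close>.\<close>
  have "0 \<le> (A + 2 * (- B / C) * B + (- B / C)\<^sup>2 * C) * C"
    by (rule mult_nonneg_nonneg[OF assms])
  also have "\<dots> = A * C - B\<^sup>2"
    using False by (simp add: field_simps power2_eq_square)
  finally show ?thesis by simp
qed

lemma qip_Cauchy_Schwarz:
  assumes "f \<in> qL2" "g \<in> qL2"
  shows "(qip f g)\<^sup>2 \<le> qip f f * qip g g"
proof (rule quadratic_nonneg_imp_discriminant)
  fix t :: real
  have "0 \<le> qip (\<lambda>p. f p + t *\<^sub>R g p) (\<lambda>p. f p + t *\<^sub>R g p)" by (rule qip_nonneg)
  also have "\<dots> = qip f f + 2 * t * qip f g + t\<^sup>2 * qip g g"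
    using assms by (simp add: qip_simps qip_commute[of g f] algebra_simps power2_eq_square)
  finally show "0 \<le> qip f f + 2 * t * qip f g + t\<^sup>2 * qip g g" .
qed (rule qip_nonneg)

section \<open>Convergence in mean square\<close>

definition qconv :: "(nat \<Rightarrow> real \<times> real \<Rightarrow> quat) \<Rightarrow> (real \<times> real \<Rightarrow> quat) \<Rightarrow> bool" where
  "qconv H h \<longleftrightarrow> (\<lambda>n. qip (\<lambda>p. H n p - h p) (\<lambda>p. H n p - h p)) \<longlonglongrightarrow> 0"

text \<open>The distance in \<open>qconv\<close> is a Bochner integral and so is meaningful only for
  differences in \<open>qL2\<close>; there it agrees with the extended integrals of
  \<open>has_qft\<close>.\<close>

lemma qconv_iff_nn_integral:
  assumes "\<And>n. H n \<in> qL2" "h \<in> qL2"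
  shows "qconv H h \<longleftrightarrow> (\<lambda>n. \<integral>\<^sup>+ p. ennreal ((norm (H n p - h p))\<^sup>2) \<partial>lborel) \<longlonglongrightarrow> 0"
proof -
  have "(\<integral>\<^sup>+ p. ennreal ((norm (H n p - h p))\<^sup>2) \<partial>lborel)
      = ennreal (qip (\<lambda>p. H n p - h p) (\<lambda>p. H n p - h p))" for n
    unfolding qip_self
    by (intro nn_integral_eq_integral qL2_integrable_square qL2_diff assms) simp
  then show ?thesis
    unfolding qconv_def
    using tendsto_ennreal_iff[of "\<lambda>n. qip (\<lambda>p. H n p - h p) (\<lambda>p. H n p - h p)" sequentially 0]
    by (simp add: qip_nonneg)
qed

lemma qip_tendsto_0:
  assumes "(\<lambda>n. qip (A n) (A n)) \<longlonglongrightarrow> 0" "\<And>n. A n \<in> qL2" "\<And>n. B n \<in> qL2"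
    and "\<And>n. qip (B n) (B n) \<le> C"
  shows "(\<lambda>n. qip (A n) (B n)) \<longlonglongrightarrow> 0"
proof -
  have "(\<lambda>n. (qip (A n) (B n))\<^sup>2) \<longlonglongrightarrow> 0"
  proof (rule tendsto_sandwich[OF _ _ tendsto_const])
    show "(\<lambda>n. qip (A n) (A n) * C) \<longlonglongrightarrow> 0"
      using tendsto_mult_right[OF assms(1), of C] by simp
    show "\<forall>\<^sub>F n in sequentially. (qip (A n) (B n))\<^sup>2 \<le> qip (A n) (A n) * C"
      using order_trans[OF qip_Cauchy_Schwarz[OF assms(2,3)] mult_left_mono[OF assms(4) qip_nonneg]]
      by simp
  qed simp
  then show ?thesis by simp
qed

lemma qip_self_diff_le:
  assumes "f \<in> qL2" "g \<in> qL2" "h \<in> qL2"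
  shows "qip (\<lambda>p. f p - h p) (\<lambda>p. f p - h p)
    \<le> 2 * qip (\<lambda>p. f p - g p) (\<lambda>p. f p - g p) + 2 * qip (\<lambda>p. g p - h p) (\<lambda>p. g p - h p)"
proof -
  \<comment> \<open>The parallelogram law for \<open>f - g\<close> and \<open>g - h\<close>: their
    difference is \<open>f - 2 g + h\<close>, and its square is dropped. This replaces the triangle
    inequality without taking roots.\<close>
  have "0 \<le> qip (\<lambda>p. f p - 2 *\<^sub>R g p + h p) (\<lambda>p. f p - 2 *\<^sub>R g p + h p)" by (rule qip_nonneg)
  then show ?thesis
    using assms by (simp add: qip_simps qip_commute[of g f] qip_commute[of h f] qip_commute[of h g])
qed

lemma qip_tendsto:
  assumes H: "\<And>n. H n \<in> qL2" "h \<in> qL2" "qconv H h"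
    and G: "\<And>n. G n \<in> qL2" "g \<in> qL2" "qconv G g"
  shows "(\<lambda>n. qip (H n) (G n)) \<longlonglongrightarrow> qip h g"
proof -
  have dH: "(\<lambda>p. H n p - h p) \<in> qL2" and dG: "(\<lambda>p. G n p - g p) \<in> qL2" for n
    using H G by (auto intro: qL2_diff)
  have "Bseq (\<lambda>n. qip (\<lambda>p. G n p - g p) (\<lambda>p. G n p - g p))"
    by (rule convergent_imp_Bseq[OF convergentI[OF G(3)[unfolded qconv_def]]])
  then obtain C where C0: "norm (qip (\<lambda>p. G n p - g p) (\<lambda>p. G n p - g p)) \<le> C" for n
    by (rule BseqE) (rule that, erule spec)
  have C: "qip (\<lambda>p. G n p - g p) (\<lambda>p. G n p - g p) \<le> C" for n
    using C0[of n] by (simp add: abs_le_iff)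
  have "(\<lambda>n. qip (\<lambda>p. H n p - h p) (\<lambda>p. G n p - g p) + qip (\<lambda>p. H n p - h p) g
          + qip (\<lambda>p. G n p - g p) h) \<longlonglongrightarrow> 0 + 0 + 0"
    by (intro tendsto_add
        qip_tendsto_0[OF H(3)[unfolded qconv_def] dH dG C]
        qip_tendsto_0[OF H(3)[unfolded qconv_def] dH G(2) order_refl]
        qip_tendsto_0[OF G(3)[unfolded qconv_def] dG H(2) order_refl])
  moreover have "qip (\<lambda>p. H n p - h p) (\<lambda>p. G n p - g p) + qip (\<lambda>p. H n p - h p) g
          + qip (\<lambda>p. G n p - g p) h = qip (H n) (G n) - qip h g" for n
    using H G by (simp add: qip_simps qip_commute[of "G n" h] qip_commute[of g h])
  ultimately show ?thesis by (simp add: LIM_zero_iff)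
qed

lemma qconv_dominated:
  assumes H: "\<And>n. H n \<in> qL2" and h: "h \<in> qL2" and "integrable lborel w"
    and "AE p in lborel. (\<lambda>n. H n p) \<longlonglongrightarrow> h p"
    and "\<And>n. AE p in lborel. (norm (H n p - h p))\<^sup>2 \<le> w p"
  shows "qconv H h"
proof -
  have "(\<lambda>n. LINT p|lborel. (norm (H n p - h p))\<^sup>2) \<longlonglongrightarrow> (LINT p|(lborel :: (real \<times> real) measure). 0)"
  proof (rule integral_dominated_convergence[where w = w])
    show "AE p in lborel. (\<lambda>n. (norm (H n p - h p))\<^sup>2) \<longlonglongrightarrow> 0"
      using assms(4)
    proof eventually_elim
      case (elim p)
      then have "(\<lambda>n. (norm (H n p - h p))\<^sup>2) \<longlonglongrightarrow> 0\<^sup>2"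
        by (intro tendsto_power tendsto_norm_zero) (simp add: LIM_zero_iff)
      then show ?case by simp
    qed
    show "(\<lambda>p. (norm (H n p - h p))\<^sup>2) \<in> borel_measurable lborel" for n
      using H h by measurable
  qed (use assms in auto)
  then show ?thesis by (simp add: qconv_def qip_self)
qed

subsection \<open>Continuity of translations\<close>

lemma
  fixes f :: "'a::euclidean_space \<Rightarrow> 'b::{banach, second_countable_topology}"
  assumes [measurable]: "f \<in> borel_measurable borel"
  shows integral_lborel_translate: "(LINT x|lborel. f (x + c)) = (LINT x|lborel. f x)"
    and integrable_lborel_translate_iff: "integrable lborel (\<lambda>x. f (x + c)) \<longleftrightarrow> integrable lborel f"
proof -
  have "(LINT x|distr lborel borel ((+) c). f x) = (LINT x|lborel. f (c + x))"
    by (rule integral_distr) measurable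
  then show "(LINT x|lborel. f (x + c)) = (LINT x|lborel. f x)"
    by (simp add: lborel_distr_plus add.commute)
  have "integrable (distr lborel borel ((+) c)) f \<longleftrightarrow> integrable lborel (\<lambda>x. f (c + x))"
    by (rule integrable_distr_eq) measurable
  then show "integrable lborel (\<lambda>x. f (x + c)) \<longleftrightarrow> integrable lborel f"
    by (simp add: lborel_distr_plus add.commute)
qed

lemma qL2_translate:
  assumes "f \<in> qL2"
  shows "(\<lambda>p. f (p + z)) \<in> qL2"
proof -
  have [measurable]: "f \<in> borel_measurable borel" using assms by measurable
  have "integrable lborel (\<lambda>p. (\<lambda>p. (norm (f p))\<^sup>2) (p + z))"
    by (subst integrable_lborel_translate_iff) (use assms in \<open>simp_all add: qL2_integrable_square\<close>)
  then show ?thesis by (simp add: qL2_def)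
qed

lemma qip_translate:
  assumes "f \<in> qL2" "g \<in> qL2"
  shows "qip (\<lambda>p. f (p + z)) (\<lambda>p. g (p + z)) = qip f g"
  unfolding qip_def
  by (rule integral_lborel_translate[where f = "\<lambda>p. inner (f p) (g p)"]) (use assms in measurable)

text \<open>The first factor falls linearly from 1 to 0 as the norm of \<open>p\<close> goes from
  \<open>k\<close> to \<open>k + 1\<close>; the second pulls \<open>q\<close> into the ball of
  radius \<open>Suc k\<close>. Both are continuous, so that truncation preserves continuous
  functions and passes to pointwise limits, which an indicator cutoff would not do.\<close>

definition qtrunc :: "nat \<Rightarrow> real \<times> real \<Rightarrow> quat \<Rightarrow> quat" where
  "qtrunc k p q = (max 0 (min 1 (real k + 1 - norm p)) * (real (Suc k) / max (real (Suc k)) (norm q))) *\<^sub>R q"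

lemma qtrunc_pos: "0 < max (real (Suc k)) (norm q)"
  by (rule max.strict_coboundedI1) simp

lemma qtrunc_continuous:
  assumes "continuous_on UNIV g"
  shows "continuous_on UNIV (\<lambda>p. qtrunc k p (g p))"
proof -
  have "max (real (Suc k)) (norm (g p)) \<noteq> 0" for p using qtrunc_pos by (rule less_imp_neq[symmetric])
  then show ?thesis
    unfolding qtrunc_def by (intro continuous_intros continuous_on_max continuous_on_min assms ballI)
qed

lemma qtrunc_tendsto:
  assumes "(X \<longlonglongrightarrow> q)"
  shows "(\<lambda>n. qtrunc k p (X n)) \<longlonglongrightarrow> qtrunc k p q"
proof -
  have "max (real (Suc k)) (norm q) \<noteq> 0" using qtrunc_pos by (rule less_imp_neq[symmetric])
  then show ?thesis
    unfolding qtrunc_def by (intro tendsto_intros tendsto_max assms)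
qed

lemma qtrunc_eq_scaleR:
  obtains m where "0 \<le> m" "m \<le> 1" "qtrunc k p q = m *\<^sub>R q"
proof
  have "real (Suc k) / max (real (Suc k)) (norm q) \<le> 1"
    by (simp only: divide_le_eq_1_pos[OF qtrunc_pos] max.cobounded1)
  moreover have "0 \<le> real (Suc k) / max (real (Suc k)) (norm q)"
    by (intro divide_nonneg_pos qtrunc_pos) simp
  ultimately show "0 \<le> max 0 (min 1 (real k + 1 - norm p)) * (real (Suc k) / max (real (Suc k)) (norm q))"
    "max 0 (min 1 (real k + 1 - norm p)) * (real (Suc k) / max (real (Suc k)) (norm q)) \<le> 1"
    by (simp_all only: mult_nonneg_nonneg mult_le_one max.cobounded1 max.bounded_iff min.cobounded1
        zero_le_one simp_thms)
qed (simp only: qtrunc_def)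

lemma norm_qtrunc_le: "norm (qtrunc k p q) \<le> real (Suc k)"
proof -
  have "max 0 (min 1 (real k + 1 - norm p)) * (real (Suc k) / max (real (Suc k)) (norm q) * norm q)
    \<le> 1 * real (Suc k)"
  proof (rule mult_mono)
    have "norm q / max (real (Suc k)) (norm q) \<le> 1"
      by (simp only: divide_le_eq_1_pos[OF qtrunc_pos] max.cobounded2)
    then have "real (Suc k) * (norm q / max (real (Suc k)) (norm q)) \<le> real (Suc k)"
      by (intro mult_left_le) auto
    then show "real (Suc k) / max (real (Suc k)) (norm q) * norm q \<le> real (Suc k)" by simp
  qed (auto simp: max_def)
  then show ?thesis
    by (simp add: qtrunc_def abs_mult mult.assoc)
qed

lemma qtrunc_eq_0: "norm p > real (Suc k) \<Longrightarrow> qtrunc k p q = 0"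
  by (simp add: qtrunc_def)

lemma qtrunc_tendsto_self: "(\<lambda>k. qtrunc k p q) \<longlonglongrightarrow> q"
proof (rule tendsto_eventually)
  obtain K where K: "norm p + norm q \<le> real K" using real_arch_simple by auto
  have "qtrunc k p q = q" if "k \<ge> K" for k
  proof -
    have "norm p + norm q \<le> real k" using K that by linarith
    then have "norm p \<le> real k" "norm q \<le> real k"
      using norm_ge_zero[of p] norm_ge_zero[of q] by linarith+
    then show ?thesis by (simp add: qtrunc_def)
  qed
  then show "\<forall>\<^sub>F k in sequentially. qtrunc k p q = q"
    by (auto simp: eventually_sequentially)
qed

lemma measurable_qtrunc [measurable]:
  assumes [measurable]: "f \<in> borel_measurable borel"
  shows "(\<lambda>p. qtrunc k p (f p)) \<in> borel_measurable borel"
proof -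
  define c where "c = real (Suc k)"
  show ?thesis unfolding qtrunc_def c_def[symmetric] by measurable
qed

lemma integrable_indicator_bounded:
  fixes A :: "'a::euclidean_space set"
  assumes "bounded A" "A \<in> sets borel"
  shows "integrable lborel (indicator A :: 'a \<Rightarrow> real)"
  using emeasure_bounded_finite[OF assms(1)] assms(2) by (intro integrable_real_indicator) auto

lemma qL2_bounded_support:
  assumes "g \<in> borel_measurable borel" "\<And>p. norm (g p) \<le> M" "\<And>p. norm p > R \<Longrightarrow> g p = 0"
  shows "g \<in> qL2"
proof (rule qL2I)
  have "integrable lborel (indicator (cball 0 R) :: real \<times> real \<Rightarrow> real)"
    by (rule integrable_indicator_bounded) auto
  then show "integrable lborel (\<lambda>p::real \<times> real. M\<^sup>2 * indicator (cball 0 R) p)"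
    by (intro integrable_mult_right)
  show "(norm (g p))\<^sup>2 \<le> M\<^sup>2 * indicator (cball 0 R) p" for p
  proof (cases "norm p \<le> R")
    case True
    then show ?thesis using assms(2)[of p] by (simp add: power_mono)
  next
    case False
    then show ?thesis using assms(3)[of p] by simp
  qed
qed (use assms(1) in auto)

text \<open>First \<open>f\<close> is truncated, then the same truncation is applied to continuous
  functions that tend to \<open>f\<close> off a negligible set. Truncation supplies the integrable
  majorant that these functions lack by themselves.\<close>

lemma qL2_dense_continuous:
  assumes f: "f \<in> qL2" and "e > 0"
  obtains g R M where "continuous_on UNIV g" "\<And>p. norm (g p) \<le> M" "\<And>p. norm p > R \<Longrightarrow> g p = 0"
    "qip (\<lambda>p. f p - g p) (\<lambda>p. f p - g p) < e"
proof -
  have [measurable]: "f \<in> borel_measurable borel" using f by measurable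
  have tr: "(\<lambda>p. qtrunc k p (h p)) \<in> qL2" if "h \<in> borel_measurable borel" for k h
    by (rule qL2_bounded_support[OF measurable_qtrunc[OF that] norm_qtrunc_le qtrunc_eq_0])
  have "qconv (\<lambda>k p. qtrunc k p (f p)) f"
  proof (rule qconv_dominated[OF _ f qL2_integrable_square[OF f]])
    have "norm (qtrunc k p q - q) \<le> norm q" for k p q
    proof -
      obtain m where "0 \<le> m" "m \<le> 1" "qtrunc k p q = m *\<^sub>R q" by (rule qtrunc_eq_scaleR)
      then have "norm (qtrunc k p q - q) = (1 - m) * norm q"
        by (simp flip: scaleR_diff_left[of m 1, simplified])
      also have "\<dots> \<le> 1 * norm q" using \<open>0 \<le> m\<close> by (intro mult_right_mono) auto
      finally show ?thesis by simp
    qed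
    then show "AE p in lborel. (norm (qtrunc k p (f p) - f p))\<^sup>2 \<le> (norm (f p))\<^sup>2" for k
      by (simp add: power_mono)
  qed (simp_all add: tr qtrunc_tendsto_self)
  \<comment> \<open>Each of the two approximations may cost \<open>e / 4\<close>, as
    \<open>qip_self_diff_le\<close> doubles both.\<close>
  then obtain k where k: "qip (\<lambda>p. qtrunc k p (f p) - f p) (\<lambda>p. qtrunc k p (f p) - f p) < e / 4"
    unfolding qconv_def using order_tendstoD(2)[of _ 0 sequentially "e / 4"] \<open>e > 0\<close>
    by (fastforce simp: eventually_sequentially)
  have "f measurable_on UNIV"
    by (rule lebesgue_measurable_imp_measurable_on) (auto intro: measurable_completion)
  then obtain N g where N: "negligible N" and g: "\<And>n. continuous_on UNIV (g n)"
    and gf: "\<And>p. p \<notin> N \<Longrightarrow> (\<lambda>n. g n p) \<longlonglongrightarrow> f p"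
    unfolding measurable_on_def by auto
  have gm: "g n \<in> borel_measurable borel" for n
    using g by (rule borel_measurable_continuous_onI)
  have ae: "AE p in lborel. p \<notin> N"
    using AE_not_in[OF N[unfolded negligible_iff_null_sets]] by (simp only: AE_completion_iff)
  have "qconv (\<lambda>n p. qtrunc k p (g n p)) (\<lambda>p. qtrunc k p (f p))"
  proof (rule qconv_dominated[where w = "\<lambda>p. (2 * real (Suc k))\<^sup>2 * indicator (cball 0 (real (Suc k))) p"])
    have "integrable lborel (indicator (cball 0 (real (Suc k))) :: real \<times> real \<Rightarrow> real)"
      by (rule integrable_indicator_bounded) auto
    then show "integrable lborel (\<lambda>p::real \<times> real. (2 * real (Suc k))\<^sup>2 * indicator (cball 0 (real (Suc k))) p)"
      by (intro integrable_mult_right)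
    show "AE p in lborel. (\<lambda>n. qtrunc k p (g n p)) \<longlonglongrightarrow> qtrunc k p (f p)"
      using ae by eventually_elim (intro qtrunc_tendsto gf)
    have "(norm (qtrunc k p a - qtrunc k p b))\<^sup>2 \<le> (2 * real (Suc k))\<^sup>2 * indicator (cball 0 (real (Suc k))) p"
      for p a b
    proof (cases "norm p \<le> real (Suc k)")
      case True
      have "norm (qtrunc k p a - qtrunc k p b) \<le> 2 * real (Suc k)"
        unfolding mult_2 by (intro norm_triangle_le_diff add_mono norm_qtrunc_le)
      then have "(norm (qtrunc k p a - qtrunc k p b))\<^sup>2 \<le> (2 * real (Suc k))\<^sup>2"
        by (rule power_mono) simp
      then show ?thesis using True by (simp add: indicator_def)
    next
      case False
      then show ?thesis by (simp add: qtrunc_eq_0)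
    qed
    then show "AE p in lborel. (norm (qtrunc k p (g n p) - qtrunc k p (f p)))\<^sup>2
        \<le> (2 * real (Suc k))\<^sup>2 * indicator (cball 0 (real (Suc k))) p" for n
      by (intro AE_I2)
  qed (simp_all add: tr gm)
  then obtain n where n: "qip (\<lambda>p. qtrunc k p (g n p) - qtrunc k p (f p)) (\<lambda>p. qtrunc k p (g n p) - qtrunc k p (f p)) < e / 4"
    unfolding qconv_def using order_tendstoD(2)[of _ 0 sequentially "e / 4"] \<open>e > 0\<close>
    by (fastforce simp: eventually_sequentially)
  show thesis
  proof (rule that[of "\<lambda>p. qtrunc k p (g n p)"])
    have swap: "qip (\<lambda>p. a p - b p) (\<lambda>p. a p - b p) = qip (\<lambda>p. b p - a p) (\<lambda>p. b p - a p)" for a b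
      by (simp add: qip_self norm_minus_commute)
    show "qip (\<lambda>p. f p - qtrunc k p (g n p)) (\<lambda>p. f p - qtrunc k p (g n p)) < e"
      using qip_self_diff_le[OF tr[OF gm, of k n] tr[of f k] f] k n
      by (subst swap) simp
  qed (use norm_qtrunc_le qtrunc_eq_0 qtrunc_continuous[OF g] in auto)
qed

text \<open>For a continuous function of bounded support this is dominated convergence; the general
  case follows by density, because translation preserves \<open>qip\<close>.\<close>

lemma qconv_translate:
  assumes f: "f \<in> qL2" and z: "z \<longlonglongrightarrow> 0"
  shows "qconv (\<lambda>n p. f (p + z n)) f"
  unfolding qconv_def
proof (rule order_tendstoI)
  fix a :: real assume "a < 0"
  then show "\<forall>\<^sub>F n in sequentially. a < qip (\<lambda>p. f (p + z n) - f p) (\<lambda>p. f (p + z n) - f p)"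
    by (intro always_eventually allI less_le_trans[OF _ qip_nonneg])
next
  fix e :: real assume "0 < e"
  \<comment> \<open>Two uses of \<open>qip_self_diff_le\<close> give the three distances the weights
    2, 4 and 4, and ten twelfths of \<open>e\<close> stay below \<open>e\<close>.\<close>
  then have "e / 12 > 0" by simp
  with f obtain g R M where g: "continuous_on UNIV g" and M: "\<And>p. norm (g p) \<le> M"
    and R: "\<And>p. norm p > R \<Longrightarrow> g p = 0"
    and e: "qip (\<lambda>p. f p - g p) (\<lambda>p. f p - g p) < e / 12"
    by (rule qL2_dense_continuous) (rule that)
  have gm: "g \<in> borel_measurable borel"
    using g by (rule borel_measurable_continuous_onI)
  have gL: "g \<in> qL2"
    by (rule qL2_bounded_support[OF gm M R])
  \<comment> \<open>Bounded shifts keep all translates of \<open>g\<close> supported in one ball,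
    which provides the majorant.\<close>
  have "Bseq z" by (rule convergent_imp_Bseq[OF convergentI[OF z]])
  then obtain K where K: "\<And>n. norm (z n) \<le> K" "K > 0"
    by (rule BseqE) (rule that, erule spec)
  have "qconv (\<lambda>n p. g (p + z n)) g"
  proof (rule qconv_dominated[where w = "\<lambda>p. (2 * M)\<^sup>2 * indicator (cball 0 (R + K)) p"])
    have "integrable lborel (indicator (cball 0 (R + K)) :: real \<times> real \<Rightarrow> real)"
      by (rule integrable_indicator_bounded) auto
    then show "integrable lborel (\<lambda>p::real \<times> real. (2 * M)\<^sup>2 * indicator (cball 0 (R + K)) p)"
      by (intro integrable_mult_right)
    have "(\<lambda>n. g (p + z n)) \<longlonglongrightarrow> g p" for p
    proof -
      have "(\<lambda>n. p + z n) \<longlonglongrightarrow> p + 0" by (intro tendsto_intros z)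
      from continuous_on_tendsto_compose[OF g this] show ?thesis by simp
    qed
    then show "AE p in lborel. (\<lambda>n. g (p + z n)) \<longlonglongrightarrow> g p" by (intro AE_I2)
    have "(norm (g (p + z n) - g p))\<^sup>2 \<le> (2 * M)\<^sup>2 * indicator (cball 0 (R + K)) p" for n p
    proof (cases "norm p \<le> R + K")
      case True
      have "norm (g (p + z n) - g p) \<le> 2 * M"
        using norm_triangle_ineq4[of "g (p + z n)" "g p"] M[of p] M[of "p + z n"] by linarith
      then have "(norm (g (p + z n) - g p))\<^sup>2 \<le> (2 * M)\<^sup>2" by (rule power_mono) simp
      then show ?thesis using True by (simp add: indicator_def)
    next
      case False
      then have "norm p > R" using K(2) by simp
      moreover have "norm (p + z n) > R"
        using norm_diff_ineq[of p "z n"] K(1)[of n] False by linarith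
      ultimately show ?thesis using R by simp
    qed
    then show "AE p in lborel. (norm (g (p + z n) - g p))\<^sup>2 \<le> (2 * M)\<^sup>2 * indicator (cball 0 (R + K)) p" for n
      by (intro AE_I2)
  qed (simp_all add: gL qL2_translate)
  then have "\<forall>\<^sub>F n in sequentially. qip (\<lambda>p. g (p + z n) - g p) (\<lambda>p. g (p + z n) - g p) < e / 12"
    unfolding qconv_def by (rule order_tendstoD(2)) (use \<open>0 < e\<close> in simp)
  then show "\<forall>\<^sub>F n in sequentially. qip (\<lambda>p. f (p + z n) - f p) (\<lambda>p. f (p + z n) - f p) < e"
  proof eventually_elim
    case (elim n)
    note L = qL2_translate[OF f, of "z n"] qL2_translate[OF gL, of "z n"]
    have "qip (\<lambda>p. f (p + z n) - g (p + z n)) (\<lambda>p. f (p + z n) - g (p + z n)) < e / 12"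
      using e qip_translate[OF qL2_diff[OF f gL] qL2_diff[OF f gL], of "z n"] by simp
    moreover have "qip (\<lambda>p. g p - f p) (\<lambda>p. g p - f p) < e / 12"
      using e by (simp add: qip_self norm_minus_commute)
    moreover note qip_self_diff_le[OF L f] qip_self_diff_le[OF L(2) gL f]
    ultimately show ?case using elim \<open>0 < e\<close> by linarith
  qed
qed

subsection \<open>Multipliers for the transform\<close>

lemma
  fixes f :: "'a::euclidean_space \<Rightarrow> real" and g :: "'b::euclidean_space \<Rightarrow> real"
  assumes f: "integrable lborel f" and g: "integrable lborel g"
  shows integrable_lborel_times: "integrable (lborel \<Otimes>\<^sub>M lborel) (\<lambda>(x, y). f x * g y)"
    and integral_lborel_times: "(LINT w|(lborel \<Otimes>\<^sub>M lborel). f (fst w) * g (snd w)) = (LINT x|lborel. f x) * (LINT y|lborel. g y)"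
proof -
  have [measurable]: "f \<in> borel_measurable borel" "g \<in> borel_measurable borel"
    using borel_measurable_integrable[OF f] borel_measurable_integrable[OF g] by simp_all
  have *: "integrable (lborel \<Otimes>\<^sub>M lborel) (\<lambda>w. case w of (x, y) \<Rightarrow> f x * g y)"
  proof (rule lborel_pair.Fubini_integrable)
    show "(\<lambda>w. case w of (x, y) \<Rightarrow> f x * g y) \<in> borel_measurable (lborel \<Otimes>\<^sub>M lborel)" by measurable
    show "integrable lborel (\<lambda>x. LINT y|lborel. norm (case (x, y) of (x, y) \<Rightarrow> f x * g y))"
      using integrable_norm[OF f] by (simp add: abs_mult)
    show "AE x in lborel. integrable lborel (\<lambda>y. case (x, y) of (x, y) \<Rightarrow> f x * g y)"
      using g by simp
  qed
  then show "integrable (lborel \<Otimes>\<^sub>M lborel) (\<lambda>(x, y). f x * g y)" .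
  from lborel_pair.integral_fst'[OF *]
  show "(LINT w|(lborel \<Otimes>\<^sub>M lborel). f (fst w) * g (snd w)) = (LINT x|lborel. f x) * (LINT y|lborel. g y)"
    by (simp add: case_prod_unfold)
qed

lemma measurable_lborel_pair: "measurable (lborel \<Otimes>\<^sub>M lborel) N = measurable (borel \<Otimes>\<^sub>M borel) N"
  by (rule measurable_cong_sets) (simp_all cong: sets_pair_measure_cong)

lemma fubini_lborel_bounded:
  fixes F :: "'a::euclidean_space \<Rightarrow> 'b::euclidean_space \<Rightarrow> 'c::{banach, second_countable_topology}"
  assumes m: "(\<lambda>(x, y). F x y) \<in> borel_measurable (borel \<Otimes>\<^sub>M borel)"
    and f: "integrable lborel f" and g: "integrable lborel g"
    and le: "\<And>x y. norm (F x y) \<le> f x * g y"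
  shows "(LINT y|lborel. LINT x|lborel. F x y) = (LINT x|lborel. LINT y|lborel. F x y)"
proof (rule lborel_pair.Fubini_integral)
  show "integrable (lborel \<Otimes>\<^sub>M lborel) (case_prod F)"
  proof (rule Bochner_Integration.integrable_bound[OF integrable_lborel_times[OF f g]])
    show "case_prod F \<in> borel_measurable (lborel \<Otimes>\<^sub>M lborel)"
      using m by (simp add: measurable_lborel_pair)
    show "AE w in lborel \<Otimes>\<^sub>M lborel. norm (case_prod F w) \<le> norm (case w of (x, y) \<Rightarrow> f x * g y)"
      using order_trans[OF le abs_ge_self] by (intro AE_I2) (simp split: prod.split)
  qed
qed

definition cos_transform :: "(real \<Rightarrow> real) \<Rightarrow> real \<Rightarrow> real" where
  "cos_transform m x = (LINT u|lborel. cos (x * u) * m u)"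

lemma integral_sin_even:
  fixes m :: "real \<Rightarrow> real"
  assumes "\<And>u. m (- u) = m u"
  shows "(LINT u|lborel. sin (x * u) * m u) = 0"
  using lborel_integral_real_affine[of "- 1" "\<lambda>u. sin (x * u) * m u" 0] by (simp add: assms)

lemma integrable_trig_mult:
  fixes m :: "real \<Rightarrow> real"
  assumes "integrable lborel m"
  shows "integrable lborel (\<lambda>u. cos (x * u) * m u)" "integrable lborel (\<lambda>u. sin (x * u) * m u)"
proof -
  have [measurable]: "m \<in> borel_measurable borel"
    using borel_measurable_integrable[OF assms] by simp
  show "integrable lborel (\<lambda>u. cos (x * u) * m u)"
    by (rule Bochner_Integration.integrable_bound[OF assms])
      (auto intro!: AE_I2 mult_left_le_one_le simp: abs_mult)
  show "integrable lborel (\<lambda>u. sin (x * u) * m u)"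
    by (rule Bochner_Integration.integrable_bound[OF assms])
      (auto intro!: AE_I2 mult_left_le_one_le simp: abs_mult)
qed

text \<open>Of the four terms of \<open>qrot_trig\<close>, those containing \<open>quat_i\<close> or
  \<open>quat_j\<close> carry a sine and integrate to zero against an even weight. The
  noncommutative kernel thus collapses to a real scalar.\<close>

lemma integral_even_weight_qrot:
  fixes m1 m2 :: "real \<Rightarrow> real"
  assumes m: "integrable lborel m1" "integrable lborel m2"
    and even: "\<And>u. m1 (- u) = m1 u" "\<And>u. m2 (- u) = m2 u"
  shows "(LINT w|lborel. (m1 (fst w) * m2 (snd w)) *\<^sub>R qrot p w q)
    = (cos_transform m1 (fst p) * cos_transform m2 (snd p)) *\<^sub>R q"
proof (cases p)
  case (Pair x y)
  note i1 = integrable_trig_mult[OF m(1), of x] and i2 = integrable_trig_mult[OF m(2), of y]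
  define cc sc cs ss where "cc = (\<lambda>w. (cos (x * fst w) * m1 (fst w)) * (cos (y * snd w) * m2 (snd w)))"
    and "sc = (\<lambda>w. (sin (x * fst w) * m1 (fst w)) * (cos (y * snd w) * m2 (snd w)))"
    and "cs = (\<lambda>w. (cos (x * fst w) * m1 (fst w)) * (sin (y * snd w) * m2 (snd w)))"
    and "ss = (\<lambda>w. (sin (x * fst w) * m1 (fst w)) * (sin (y * snd w) * m2 (snd w)))"
  have I: "integrable lborel cc" "integrable lborel sc" "integrable lborel cs" "integrable lborel ss"
    using integrable_lborel_times[OF i1(1) i2(1)] integrable_lborel_times[OF i1(2) i2(1)]
      integrable_lborel_times[OF i1(1) i2(2)] integrable_lborel_times[OF i1(2) i2(2)]
    unfolding cc_def sc_def cs_def ss_def lborel_prod case_prod_unfold by simp_all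
  have V: "(LINT w|lborel. cc w) = cos_transform m1 x * cos_transform m2 y"
    "(LINT w|lborel. sc w) = 0" "(LINT w|lborel. cs w) = 0" "(LINT w|lborel. ss w) = 0"
    using integral_lborel_times[OF i1(1) i2(1)] integral_lborel_times[OF i1(2) i2(1)]
      integral_lborel_times[OF i1(1) i2(2)] integral_lborel_times[OF i1(2) i2(2)]
    unfolding cc_def sc_def cs_def ss_def lborel_prod
    by (simp_all add: integral_sin_even even cos_transform_def)
  have "(m1 (fst w) * m2 (snd w)) *\<^sub>R qrot p w q =
      cc w *\<^sub>R q - sc w *\<^sub>R (quat_i * q) - cs w *\<^sub>R (q * quat_j) + ss w *\<^sub>R (quat_i * q * quat_j)" for w
    unfolding Pair cc_def sc_def cs_def ss_def
    by (subst surjective_pairing[of w], subst qrot_trig)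
      (simp only: scaleR_right_distrib scaleR_right_diff_distrib scaleR_scaleR mult.commute mult.left_commute)
  then have "(LINT w|lborel. (m1 (fst w) * m2 (snd w)) *\<^sub>R qrot p w q) =
      (LINT w|lborel. cc w *\<^sub>R q - sc w *\<^sub>R (quat_i * q) - cs w *\<^sub>R (q * quat_j) + ss w *\<^sub>R (quat_i * q * quat_j))"
    by (simp only:)
  also have "\<dots> = (LINT w|lborel. cc w) *\<^sub>R q - (LINT w|lborel. sc w) *\<^sub>R (quat_i * q)
      - (LINT w|lborel. cs w) *\<^sub>R (q * quat_j) + (LINT w|lborel. ss w) *\<^sub>R (quat_i * q * quat_j)"
    using I by (simp add: Bochner_Integration.integral_add Bochner_Integration.integral_diff)
  finally show ?thesis by (simp add: V Pair)
qed

lemma qL1_measurable [measurable_dest]: "h \<in> qL1 \<Longrightarrow> h \<in> borel_measurable borel"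
  using borel_measurable_integrable[of lborel h] by (simp add: qL1_def)

lemma qL1_integrable_qrot:
  assumes "h \<in> qL1"
  shows "integrable lborel (\<lambda>p. qrot p w (h p))"
proof (rule Bochner_Integration.integrable_bound)
  show "integrable lborel h" using assms by (simp add: qL1_def)
  show "(\<lambda>p. qrot p w (h p)) \<in> borel_measurable lborel" using assms by measurable
qed simp

lemma qft_L1_measurable [measurable]:
  assumes "h \<in> qL1"
  shows "qft_L1 h \<in> borel_measurable borel"
proof -
  have [measurable]: "h \<in> borel_measurable borel" using assms by measurable
  have "(\<lambda>w. LINT p|lborel. qrot p w (h p)) \<in> borel_measurable borel"
    by measurable
  then show ?thesis by (simp add: qft_L1_eq[abs_def])
qed

lemma norm_qft_L1_le:
  "norm (qft_L1 h w) \<le> (LINT p|lborel. norm (h p))"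
  using integral_norm_bound[of lborel "\<lambda>p. qrot p w (h p)"] by (simp add: qft_L1_eq)

lemma qft_L1_add: "h \<in> qL1 \<Longrightarrow> g \<in> qL1 \<Longrightarrow> qft_L1 (\<lambda>p. h p + g p) w = qft_L1 h w + qft_L1 g w"
  by (simp add: qft_L1_eq linear_add[OF linear_qrot] Bochner_Integration.integral_add qL1_integrable_qrot)

lemma qft_L1_minus_eq: "qft_L1 h (- p) = (LINT w|lborel. qrot (- p) w (h w))"
  by (simp add: qft_L1_eq qrot_commute[of "- p"])

text \<open>Fubini moves the kernel to the other factor of the inner product, where it appears as
  its adjoint, the rotation by \<open>- p\<close>.\<close>

lemma qft_L1_transfer:
  assumes h: "h \<in> qL1" and k: "k \<in> qL1"
  shows "(LINT w|lborel. inner (qft_L1 h w) (k w)) = (LINT p|lborel. inner (h p) (qft_L1 k (- p)))"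
proof -
  have [measurable]: "h \<in> borel_measurable borel" "k \<in> borel_measurable borel"
    using h k by measurable
  have "(LINT w|lborel. inner (qft_L1 h w) (k w)) = (LINT w|lborel. LINT p|lborel. inner (qrot p w (h p)) (k w))"
    by (simp add: qft_L1_eq integral_inner_left[OF qL1_integrable_qrot[OF h]])
  also have "\<dots> = (LINT p|lborel. LINT w|lborel. inner (qrot p w (h p)) (k w))"
  proof (rule fubini_lborel_bounded)
    show "integrable lborel (\<lambda>p. norm (h p))" "integrable lborel (\<lambda>p. norm (k p))"
      using h k by (simp_all add: qL1_def)
    show "norm (inner (qrot p w (h p)) (k w)) \<le> norm (h p) * norm (k w)" for p w
      using Cauchy_Schwarz_ineq2[of "qrot p w (h p)" "k w"] by simp
  qed measurable
  also have "\<dots> = (LINT p|lborel. LINT w|lborel. inner (h p) (qrot (- p) w (k w)))"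
    by (simp add: inner_qrot)
  also have "\<dots> = (LINT p|lborel. inner (h p) (qft_L1 k (- p)))"
  proof -
    have "integrable lborel (\<lambda>w. qrot (- p) w (k w))" for p
      using qL1_integrable_qrot[OF k, of "- p"] by (simp add: qrot_commute[of "- p"])
    then show ?thesis
      by (simp add: qft_L1_minus_eq integral_inner_right)
  qed
  finally show ?thesis .
qed

lemma qL1_bounded_weight:
  assumes "integrable lborel m" "h \<in> borel_measurable borel" "\<And>w. norm (h w) \<le> C"
  shows "(\<lambda>w. m w *\<^sub>R h w) \<in> qL1"
  unfolding qL1_def mem_Collect_eq
proof (rule Bochner_Integration.integrable_bound)
  have [measurable]: "m \<in> borel_measurable borel"
    using borel_measurable_integrable[OF assms(1)] by simp
  show "integrable lborel (\<lambda>w. C * m w)" using assms(1) by simp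
  show "(\<lambda>w. m w *\<^sub>R h w) \<in> borel_measurable lborel" using assms(2) by measurable
  have "norm (m w *\<^sub>R h w) \<le> norm (C * m w)" for w
    using mult_left_mono[OF order_trans[OF assms(3) abs_ge_self], of "\<bar>m w\<bar>" w]
    by (simp add: abs_mult mult.commute)
  then show "AE w in lborel. norm (m w *\<^sub>R h w) \<le> norm (C * m w)" by (intro AE_I2)
qed

lemma integrable_weight:
  assumes "integrable lborel m1" "integrable lborel m2"
  shows "integrable lborel (\<lambda>w::real \<times> real. m1 (fst w) * m2 (snd w) :: real)"
  using integrable_lborel_times[OF assms] by (simp add: lborel_prod case_prod_unfold)

text \<open>Up to a constant, the transform at \<open>- p\<close> is the inverse transform at
  \<open>p\<close>, so this is a convolution theorem for the weights considered here. The rotations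
  by \<open>p'\<close> and \<open>- p\<close> compose to the rotation by \<open>p' - p\<close>,
  which \<open>integral_even_weight_qrot\<close> evaluates.\<close>

lemma qft_L1_multiplier:
  fixes m1 m2 :: "real \<Rightarrow> real"
  assumes g: "g \<in> qL1" and m: "integrable lborel m1" "integrable lborel m2"
    and even: "\<And>u. m1 (- u) = m1 u" "\<And>u. m2 (- u) = m2 u"
  shows "qft_L1 (\<lambda>w. (m1 (fst w) * m2 (snd w)) *\<^sub>R qft_L1 g w) (- p) =
    (LINT p'|lborel. (cos_transform m1 (fst p' - fst p) * cos_transform m2 (snd p' - snd p)) *\<^sub>R g p')"
proof -
  define M where "M = (\<lambda>w. m1 (fst w) * m2 (snd w))"
  have MI: "integrable lborel M"
    unfolding M_def by (rule integrable_weight[OF m])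
  have [measurable]: "g \<in> borel_measurable borel" using g by measurable
  have [measurable]: "M \<in> borel_measurable borel"
    using borel_measurable_integrable[OF MI] by simp
  have "qft_L1 (\<lambda>w. M w *\<^sub>R qft_L1 g w) (- p) = (LINT w|lborel. qrot (- p) w (M w *\<^sub>R qft_L1 g w))"
    by (rule qft_L1_minus_eq)
  also have "\<dots> = (LINT w|lborel. LINT p'|lborel. M w *\<^sub>R qrot (p' - p) w (g p'))"
  proof (rule Bochner_Integration.integral_cong[OF refl])
    fix w
    have "qrot (- p) w (M w *\<^sub>R qft_L1 g w) = M w *\<^sub>R qrot (- p) w (LINT p'|lborel. qrot p' w (g p'))"
      by (simp add: linear_scale[OF linear_qrot] qft_L1_eq)
    also have "qrot (- p) w (LINT p'|lborel. qrot p' w (g p')) = (LINT p'|lborel. qrot (- p) w (qrot p' w (g p')))"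
      by (rule integral_bounded_linear[OF bounded_linear_qrot qL1_integrable_qrot[OF g], symmetric])
    also have "\<dots> = (LINT p'|lborel. qrot (p' - p) w (g p'))"
      by (simp add: qrot_qrot)
    finally show "qrot (- p) w (M w *\<^sub>R qft_L1 g w) = (LINT p'|lborel. M w *\<^sub>R qrot (p' - p) w (g p'))"
      by simp
  qed
  also have "\<dots> = (LINT p'|lborel. LINT w|lborel. M w *\<^sub>R qrot (p' - p) w (g p'))"
  proof (rule fubini_lborel_bounded)
    show "integrable lborel (\<lambda>p. norm (g p))" "integrable lborel (\<lambda>w. norm (M w))"
      using g MI by (simp_all add: qL1_def)
  qed (simp_all add: mult.commute)
  also have "\<dots> = (LINT p'|lborel. (cos_transform m1 (fst p' - fst p) * cos_transform m2 (snd p' - snd p)) *\<^sub>R g p')"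
    unfolding M_def by (simp add: integral_even_weight_qrot[OF m even])
  finally show ?thesis unfolding M_def .
qed

subsection \<open>Plancherel\<close>

lemma measurable_fst_snd_borel [measurable (raw)]:
  fixes f :: "'a \<Rightarrow> 'b::topological_space \<times> 'c::topological_space"
  assumes "f \<in> M \<rightarrow>\<^sub>M borel"
  shows "(\<lambda>x. fst (f x)) \<in> M \<rightarrow>\<^sub>M borel" "(\<lambda>x. snd (f x)) \<in> M \<rightarrow>\<^sub>M borel"
  by (intro measurable_compose[OF assms] borel_measurable_continuous_onI continuous_intros)+

section \<open>Gaussians and their cosine transforms\<close>

definition gauss :: "real \<Rightarrow> real" where
  "gauss u = exp (- u\<^sup>2 / 2)"

lemma gauss_eq: "gauss u = sqrt (2 * pi) * std_normal_density u"
  by (simp add: gauss_def std_normal_density_def)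

lemma measurable_gauss [measurable]: "gauss \<in> borel_measurable borel"
  unfolding gauss_def[abs_def] by measurable

lemma integrable_gauss: "integrable lborel gauss"
  unfolding gauss_eq[abs_def] by (intro integrable_mult_right integrable_normal_density) simp

lemma integral_gauss: "(LINT u|lborel. gauss u) = sqrt (2 * pi)"
  unfolding gauss_eq by simp

lemma gauss_pos: "0 < gauss u" and gauss_le_1: "gauss u \<le> 1" and gauss_even: "gauss (- u) = gauss u"
  by (simp_all add: gauss_def)

text \<open>Up to normalization this is the real part of the characteristic function of the standard
  normal distribution.\<close>

lemma cos_transform_gauss: "cos_transform gauss x = sqrt (2 * pi) * gauss x"
proof -
  have I: "integrable lborel (\<lambda>u. std_normal_density u *\<^sub>R iexp (x * u))"
    by (rule Bochner_Integration.integrable_bound[OF integrable_normal_density[of 1 0]])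
      (auto intro!: AE_I2)
  have "exp (- (x\<^sup>2) / 2) = Re (char std_normal_distribution x)"
    by (simp add: char_std_normal_distribution)
  also have "char std_normal_distribution x = (CLINT u|lborel. std_normal_density u *\<^sub>R iexp (x * u))"
    unfolding char_def by (rule integral_density) (auto intro!: AE_I2)
  also have "Re \<dots> = (LINT u|lborel. Re (std_normal_density u *\<^sub>R iexp (x * u)))"
    by (rule integral_Re[symmetric, OF I])
  also have "\<dots> = (LINT u|lborel. cos (x * u) * std_normal_density u)"
    by (simp add: Re_exp mult.commute)
  finally have "(LINT u|lborel. cos (x * u) * std_normal_density u) = gauss x"
    by (simp add: gauss_def)
  moreover have "cos_transform gauss x = sqrt (2 * pi) * (LINT u|lborel. cos (x * u) * std_normal_density u)"
    unfolding cos_transform_def gauss_eq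
    by (subst integral_mult_right_zero[symmetric]) (simp only: mult.left_commute)
  ultimately show ?thesis by simp
qed

lemma integrable_gauss_scaled: "c \<noteq> 0 \<Longrightarrow> integrable lborel (\<lambda>u. gauss (u * c))"
  using lborel_integrable_real_affine[OF integrable_gauss, of c 0] by (simp add: mult.commute)

lemma cos_transform_scaled:
  assumes "c > 0"
  shows "cos_transform (\<lambda>u. m (u / c)) x = c * cos_transform m (c * x)"
  unfolding cos_transform_def
  using lborel_integral_real_affine[of c "\<lambda>u. cos (x * u) * m (u / c)" 0] assms
  by (simp add: mult_ac)

lemma integral_lborel_scale:
  fixes f :: "'a::euclidean_space \<Rightarrow> 'b::{banach, second_countable_topology}"
  assumes [measurable]: "f \<in> borel_measurable borel" and "c > 0"
  shows "(LINT x|lborel. f x) = c ^ DIM('a) *\<^sub>R (LINT x|lborel. f (c *\<^sub>R x))"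
proof -
  have "(LINT x|lborel. f x)
      = (LINT x|density (distr lborel borel (\<lambda>x. 0 + c *\<^sub>R x)) (\<lambda>_. ennreal (\<bar>c\<bar> ^ DIM('a))). f x)"
    using lborel_affine[of c "0::'a"] \<open>c > 0\<close> by (simp add: ennreal_power)
  also have "\<dots> = (LINT x|distr lborel borel (\<lambda>x. 0 + c *\<^sub>R x). \<bar>c\<bar> ^ DIM('a) *\<^sub>R f x)"
    by (rule integral_density) auto
  also have "\<dots> = (LINT x|lborel. c ^ DIM('a) *\<^sub>R f (c *\<^sub>R x))"
    using \<open>c > 0\<close> by (subst integral_distr) auto
  finally show ?thesis by simp
qed

lemma qconv_const: "qconv (\<lambda>_. h) h"
  by (simp add: qconv_def qip_def)

section \<open>Autocorrelation and Gaussian-weighted energy\<close>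

definition autocorr :: "(real \<times> real \<Rightarrow> quat) \<Rightarrow> real \<times> real \<Rightarrow> real" where
  "autocorr h z = qip h (\<lambda>p. h (p + z))"

lemma measurable_autocorr [measurable]:
  assumes [measurable]: "h \<in> borel_measurable borel"
  shows "autocorr h \<in> borel_measurable borel"
  unfolding autocorr_def[abs_def] qip_def by measurable

lemma abs_autocorr_le:
  assumes "h \<in> qL2"
  shows "\<bar>autocorr h z\<bar> \<le> qip h h"
proof -
  have "(autocorr h z)\<^sup>2 \<le> qip h h * qip h h"
    using qip_Cauchy_Schwarz[OF assms qL2_translate[OF assms, of z]] qip_translate[OF assms assms, of z]
    by (simp add: autocorr_def)
  then show ?thesis
    using abs_le_square_iff[of "autocorr h z" "qip h h"] qip_nonneg[of h] by (simp add: power2_eq_square)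
qed

lemma autocorr_tendsto:
  assumes "h \<in> qL2" "z \<longlonglongrightarrow> 0"
  shows "(\<lambda>n. autocorr h (z n)) \<longlonglongrightarrow> qip h h"
  unfolding autocorr_def
  by (rule qip_tendsto[OF assms(1,1) qconv_const qL2_translate[OF assms(1)] assms(1)
        qconv_translate[OF assms]])

text \<open>For integrable \<open>h\<close> the transform is merely known to be bounded at this
  point; the weight makes its energy finite, and is removed by letting \<open>c\<close>
  grow.\<close>

definition gaussian_energy :: "(real \<times> real \<Rightarrow> quat) \<Rightarrow> real \<Rightarrow> real" where
  "gaussian_energy h c = (LINT w|lborel. gauss (fst w / c) * gauss (snd w / c) * (norm (qft_L1 h w))\<^sup>2)"

text \<open>Transfer takes the transform off one factor, the multiplier formula turns the other into
  a convolution with a Gaussian, and Fubini leaves the autocorrelation. Rescaling moves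
  \<open>c\<close> from the Gaussian into the argument of \<open>autocorr\<close>, which then tends
  to 0 as \<open>c\<close> grows.\<close>

lemma gaussian_energy_eq:
  assumes h1: "h \<in> qL1" and h2: "h \<in> qL2" and "c > 0"
  shows "gaussian_energy h c =
    2 * pi * (LINT z|lborel. gauss (fst z) * gauss (snd z) * autocorr h (z /\<^sub>R c))"
proof -
  have [measurable]: "h \<in> borel_measurable borel" using h1 by measurable
  define m where "m = (\<lambda>u. gauss (u / c))"
  have m: "integrable lborel m" "\<And>u. m (- u) = m u"
    using integrable_gauss_scaled[of "1 / c"] \<open>c > 0\<close> by (simp_all add: m_def gauss_even)
  have mc: "cos_transform m x = c * sqrt (2 * pi) * gauss (c * x)" for x
    unfolding m_def using \<open>c > 0\<close> by (simp add: cos_transform_scaled cos_transform_gauss)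
  \<comment> \<open>Each cosine transform contributes \<open>c * sqrt (2 * pi)\<close>, whence the
    factor \<open>2 * pi * c\<^sup>2\<close>; its \<open>c\<^sup>2\<close> cancels against the
    Jacobian of the final rescaling.\<close>
  define k where "k = (\<lambda>z::real \<times> real. (2 * pi * c\<^sup>2) * (gauss (c * fst z) * gauss (c * snd z)))"
  have kI: "integrable lborel k"
    unfolding k_def using \<open>c > 0\<close>
    by (intro integrable_mult_right integrable_weight[where ?m1.0 = "\<lambda>u. gauss (c * u)" and ?m2.0 = "\<lambda>u. gauss (c * u)"])
      (use integrable_gauss_scaled[of c] in \<open>simp_all add: mult.commute\<close>)
  have [measurable]: "k \<in> borel_measurable borel"
    unfolding k_def by measurable
  have k_eq: "cos_transform m a * cos_transform m b = k (a, b)" for a b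
    by (simp add: mc k_def power2_eq_square)
  have k_nonneg: "k z \<ge> 0" for z
    using gauss_pos[THEN less_imp_le] by (simp add: k_def)
  have "gaussian_energy h c
      = (LINT w|lborel. inner (qft_L1 h w) ((m (fst w) * m (snd w)) *\<^sub>R qft_L1 h w))"
    by (simp add: gaussian_energy_def m_def power2_norm_eq_inner)
  also have "\<dots> = (LINT p|lborel. inner (h p) (qft_L1 (\<lambda>w. (m (fst w) * m (snd w)) *\<^sub>R qft_L1 h w) (- p)))"
    by (intro qft_L1_transfer h1 qL1_bounded_weight[OF integrable_weight[OF m(1) m(1)]
          qft_L1_measurable[OF h1] norm_qft_L1_le])
  also have "\<dots> = (LINT p|lborel. LINT z|lborel. k z * inner (h p) (h (p + z)))"
  proof (rule Bochner_Integration.integral_cong[OF refl])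
    fix p
    define G where "G = (\<lambda>p'. k (p' - p) *\<^sub>R h p')"
    have [measurable]: "G \<in> borel_measurable borel" unfolding G_def by measurable
    have "k z \<le> 2 * pi * c\<^sup>2" for z
    proof -
      have "gauss (c * fst z) * gauss (c * snd z) \<le> 1"
        by (intro mult_le_one gauss_le_1 less_imp_le[OF gauss_pos])
      then have "(2 * pi * c\<^sup>2) * (gauss (c * fst z) * gauss (c * snd z)) \<le> (2 * pi * c\<^sup>2) * 1"
        by (intro mult_left_mono) auto
      then show ?thesis by (simp add: k_def)
    qed
    then have bd: "norm (G p') \<le> norm ((2 * pi * c\<^sup>2) *\<^sub>R h p')" for p'
      unfolding G_def using k_nonneg[of "p' - p"] by (simp add: mult_right_mono)
    have GI: "integrable lborel G"
      by (rule Bochner_Integration.integrable_bound[of _ "\<lambda>p'. (2 * pi * c\<^sup>2) *\<^sub>R h p'"])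
        (use h1 bd in \<open>auto simp: qL1_def\<close>)
    have "qft_L1 (\<lambda>w. (m (fst w) * m (snd w)) *\<^sub>R qft_L1 h w) (- p) = (LINT p'|lborel. G p')"
      using qft_L1_multiplier[OF h1 m(1) m(1) m(2) m(2), of p] by (simp add: k_eq G_def minus_prod_def)
    also have "\<dots> = (LINT z|lborel. G (z + p))"
      by (rule integral_lborel_translate[symmetric]) measurable
    finally have "inner (h p) (qft_L1 (\<lambda>w. (m (fst w) * m (snd w)) *\<^sub>R qft_L1 h w) (- p))
        = (LINT z|lborel. inner (h p) (G (z + p)))"
      using GI by (simp add: integral_inner_right integrable_lborel_translate_iff)
    then show "inner (h p) (qft_L1 (\<lambda>w. (m (fst w) * m (snd w)) *\<^sub>R qft_L1 h w) (- p))
        = (LINT z|lborel. k z * inner (h p) (h (p + z)))"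
      by (simp add: G_def add.commute)
  qed
  also have "\<dots> = (LINT z|lborel. LINT p|lborel. k z * inner (h p) (h (p + z)))"
  proof (rule lborel_pair.Fubini_integral)
    show "integrable (lborel \<Otimes>\<^sub>M lborel) (\<lambda>(z, p). k z * inner (h p) (h (p + z)))"
    proof (rule lborel_pair.Fubini_integrable)
      show "(\<lambda>(z, p). k z * inner (h p) (h (p + z))) \<in> borel_measurable (lborel \<Otimes>\<^sub>M lborel)"
        unfolding measurable_lborel_pair by measurable
      have hz: "integrable lborel (\<lambda>p. inner (h p) (h (p + z)))" for z
        by (rule qL2_integrable_inner[OF h2 qL2_translate[OF h2]])
      then show "AE z in lborel. integrable lborel (\<lambda>p. case (z, p) of (z, p) \<Rightarrow> k z * inner (h p) (h (p + z)))"
        by simp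
      \<comment> \<open>The bound is uniform in \<open>z\<close>, so the integrability of
        \<open>k\<close> alone carries the outer integral.\<close>
      have le: "(LINT p|lborel. \<bar>inner (h p) (h (p + z))\<bar>) \<le> 2 * qip h h" for z
      proof -
        have "(LINT p|lborel. \<bar>inner (h p) (h (p + z))\<bar>)
            \<le> (LINT p|lborel. (norm (h p))\<^sup>2 + (norm (h (p + z)))\<^sup>2)"
        proof (rule integral_mono)
          show "integrable lborel (\<lambda>p. \<bar>inner (h p) (h (p + z))\<bar>)"
            using hz by (rule integrable_abs)
          show "integrable lborel (\<lambda>p. (norm (h p))\<^sup>2 + (norm (h (p + z)))\<^sup>2)"
            by (intro Bochner_Integration.integrable_add qL2_integrable_square h2 qL2_translate)
          fix p
          have "\<bar>inner (h p) (h (p + z))\<bar> \<le> norm (h p) * norm (h (p + z))"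
            by (rule Cauchy_Schwarz_ineq2)
          also have "\<dots> \<le> (norm (h p))\<^sup>2 + (norm (h (p + z)))\<^sup>2"
            using sum_squares_bound[of "norm (h p)" "norm (h (p + z))"]
              mult_nonneg_nonneg[OF norm_ge_zero[of "h p"] norm_ge_zero[of "h (p + z)"]] by linarith
          finally show "\<bar>inner (h p) (h (p + z))\<bar> \<le> (norm (h p))\<^sup>2 + (norm (h (p + z)))\<^sup>2" .
        qed
        also have "\<dots> = 2 * qip h h"
          using qip_translate[OF h2 h2, of z]
          by (subst Bochner_Integration.integral_add[OF qL2_integrable_square[OF h2]
                qL2_integrable_square[OF qL2_translate[OF h2]]])
            (simp add: qip_self)
        finally show ?thesis .
      qed
      show "integrable lborel (\<lambda>z. LINT p|lborel. norm (case (z, p) of (z, p) \<Rightarrow> k z * inner (h p) (h (p + z))))"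
      proof (rule Bochner_Integration.integrable_bound)
        show "integrable lborel (\<lambda>z. k z * (2 * qip h h))" using kI by simp
        show "(\<lambda>z. LINT p|lborel. norm (case (z, p) of (z, p) \<Rightarrow> k z * inner (h p) (h (p + z)))) \<in> borel_measurable lborel"
          by measurable
        have "norm (LINT p|lborel. norm (case (z, p) of (z, p) \<Rightarrow> k z * inner (h p) (h (p + z))))
          \<le> norm (k z * (2 * qip h h))" for z
          using mult_left_mono[OF le[of z] k_nonneg[of z]]
          by (simp add: abs_mult k_nonneg qip_nonneg)
        then show "AE z in lborel. norm (LINT p|lborel. norm (case (z, p) of (z, p) \<Rightarrow> k z * inner (h p) (h (p + z))))
          \<le> norm (k z * (2 * qip h h))"
          by (intro AE_I2)
      qed
    qed
  qed
  also have "\<dots> = (LINT z|lborel. k z * autocorr h z)"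
    by (simp add: autocorr_def qip_def)
  also have "\<dots> = (1 / c)\<^sup>2 *\<^sub>R (LINT z|lborel. k ((1 / c) *\<^sub>R z) * autocorr h ((1 / c) *\<^sub>R z))"
  proof -
    have "(\<lambda>z. k z * autocorr h z) \<in> borel_measurable borel" by measurable
    from integral_lborel_scale[OF this, of "1 / c"] show ?thesis using \<open>c > 0\<close> by (simp add: power2_eq_square)
  qed
  also have "\<dots> = (1 / c)\<^sup>2 *\<^sub>R (LINT z|lborel. (2 * pi * c\<^sup>2) * (gauss (fst z) * gauss (snd z) * autocorr h (z /\<^sub>R c)))"
    using \<open>c > 0\<close> by (simp add: k_def inverse_eq_divide mult.assoc)
  also have "\<dots> = 2 * pi * (LINT z|lborel. gauss (fst z) * gauss (snd z) * autocorr h (z /\<^sub>R c))"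
    using \<open>c > 0\<close> by (simp add: power_divide)
  finally show ?thesis .
qed

text \<open>One factor \<open>2 * pi\<close> comes from the preceding formula, the other is the mass
  of the plane Gaussian; the autocorrelation tends to its value at 0 because translations are
  continuous in mean square.\<close>

lemma gaussian_energy_tendsto:
  assumes "h \<in> qL1" "h \<in> qL2"
  shows "(\<lambda>n. gaussian_energy h (real (Suc n))) \<longlonglongrightarrow> 4 * pi\<^sup>2 * qip h h"
proof -
  have [measurable]: "h \<in> borel_measurable borel" using assms by measurable
  have gI: "integrable lborel (\<lambda>z. gauss (fst z) * gauss (snd z))"
    by (intro integrable_weight integrable_gauss)
  have lim: "(\<lambda>n. LINT z|lborel. gauss (fst z) * gauss (snd z) * autocorr h (z /\<^sub>R real (Suc n)))
      \<longlonglongrightarrow> (LINT z|lborel. gauss (fst z) * gauss (snd z) * qip h h)"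
  proof (rule integral_dominated_convergence[where w = "\<lambda>z. gauss (fst z) * gauss (snd z) * qip h h"])
    show "integrable lborel (\<lambda>z. gauss (fst z) * gauss (snd z) * qip h h)"
      using gI by simp
    have "(\<lambda>n. inverse (real (Suc n)) *\<^sub>R z) \<longlonglongrightarrow> 0 *\<^sub>R z" for z :: "real \<times> real"
      by (intro tendsto_scaleR LIMSEQ_inverse_real_of_nat tendsto_const)
    then have "(\<lambda>n. autocorr h (z /\<^sub>R real (Suc n))) \<longlonglongrightarrow> qip h h" for z
      by (intro autocorr_tendsto assms) simp
    then show "AE z in lborel. (\<lambda>n. gauss (fst z) * gauss (snd z) * autocorr h (z /\<^sub>R real (Suc n)))
        \<longlonglongrightarrow> gauss (fst z) * gauss (snd z) * qip h h"
      by (intro AE_I2 tendsto_mult_left)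
    have "norm (gauss (fst z) * gauss (snd z) * autocorr h (z /\<^sub>R c)) \<le> gauss (fst z) * gauss (snd z) * qip h h" for z c
      using mult_left_mono[OF abs_autocorr_le[OF assms(2), of "z /\<^sub>R c"],
          of "gauss (fst z) * gauss (snd z)"] gauss_pos[of "fst z"] gauss_pos[of "snd z"]
      by (simp add: abs_mult)
    then show "AE z in lborel. norm (gauss (fst z) * gauss (snd z) * autocorr h (z /\<^sub>R real (Suc n)))
        \<le> gauss (fst z) * gauss (snd z) * qip h h" for n
      by (intro AE_I2)
  qed measurable
  have "(LINT z|lborel. gauss (fst z) * gauss (snd z)) = 2 * pi"
    using integral_lborel_times[OF integrable_gauss integrable_gauss]
    by (simp add: lborel_prod integral_gauss)
  then have "(LINT z|lborel. gauss (fst z) * gauss (snd z) * qip h h) = 2 * pi * qip h h"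
    by simp
  then have "(\<lambda>n. 2 * pi * (LINT z|lborel. gauss (fst z) * gauss (snd z) * autocorr h (z /\<^sub>R real (Suc n))))
      \<longlonglongrightarrow> 2 * pi * (2 * pi * qip h h)"
    using tendsto_mult_left[OF lim, of "2 * pi"] by (simp only:)
  then have "(\<lambda>n. gaussian_energy h (real (Suc n))) \<longlonglongrightarrow> 2 * pi * (2 * pi * qip h h)"
    using assms by (simp add: gaussian_energy_eq)
  then show ?thesis by (simp add: power2_eq_square mult_ac)
qed

text \<open>The Gaussian weights increase to 1, so monotone convergence applies without knowing that
  the transform is square-integrable; this comes out together with the identity.\<close>

theorem plancherel:
  assumes h1: "h \<in> qL1" and h2: "h \<in> qL2"
  shows "qft_L1 h \<in> qL2" "qip (qft_L1 h) (qft_L1 h) = 4 * pi\<^sup>2 * qip h h"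
proof -
  have [measurable]: "qft_L1 h \<in> borel_measurable borel" by (rule qft_L1_measurable[OF h1])
  define D where "D = (\<lambda>n w. gauss (fst w / real (Suc n)) * gauss (snd w / real (Suc n)))"
  have D: "0 \<le> D n w" "D n w \<le> 1" for n w
    unfolding D_def using gauss_pos[THEN less_imp_le]
    by (auto intro: mult_le_one gauss_le_1)
  have "incseq (\<lambda>n. D n w)" for w
  proof -
    have "gauss (u / real (Suc n)) \<le> gauss (u / real (Suc (Suc n)))" for u n
    proof -
      have "\<bar>u / real (Suc (Suc n))\<bar> \<le> \<bar>u / real (Suc n)\<bar>"
        by (auto simp: abs_mult divide_inverse intro!: mult_left_mono)
      then have "(u / real (Suc (Suc n)))\<^sup>2 \<le> (u / real (Suc n))\<^sup>2"
        by (rule iffD1[OF abs_le_square_iff])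
      then show ?thesis unfolding gauss_def by simp
    qed
    then show ?thesis
      unfolding D_def by (intro incseq_SucI mult_mono less_imp_le[OF gauss_pos])
  qed
  then have inc: "incseq (\<lambda>n w. ennreal (D n w * (norm (qft_L1 h w))\<^sup>2))"
    by (auto simp: incseq_def le_fun_def intro!: ennreal_leI mult_right_mono)
  have "(\<lambda>n. D n w) \<longlonglongrightarrow> 1" for w
  proof -
    have "(\<lambda>n. gauss (u / real (Suc n))) \<longlonglongrightarrow> exp (- (u * 0)\<^sup>2 / 2)" for u
      unfolding gauss_def divide_inverse[of u]
      by (intro tendsto_intros LIMSEQ_inverse_real_of_nat) simp
    from tendsto_mult[OF this this] show ?thesis by (simp add: D_def)
  qed
  then have pw: "(\<lambda>n. ennreal (D n w * (norm (qft_L1 h w))\<^sup>2)) \<longlonglongrightarrow> ennreal (1 * (norm (qft_L1 h w))\<^sup>2)" for w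
    by (intro tendsto_ennrealI tendsto_mult_right)
  have "(\<lambda>n. \<integral>\<^sup>+ w. ennreal (D n w * (norm (qft_L1 h w))\<^sup>2) \<partial>lborel)
      \<longlonglongrightarrow> (\<integral>\<^sup>+ w. ennreal (1 * (norm (qft_L1 h w))\<^sup>2) \<partial>lborel)"
    by (rule nn_integral_LIMSEQ[OF inc _ pw]) (simp add: D_def)
  moreover have "(\<integral>\<^sup>+ w. ennreal (D n w * (norm (qft_L1 h w))\<^sup>2) \<partial>lborel) = ennreal (gaussian_energy h (real (Suc n)))" for n
    unfolding gaussian_energy_def D_def
  proof (rule nn_integral_eq_integral)
    have "integrable lborel (\<lambda>w. gauss (fst w / real (Suc n)) * gauss (snd w / real (Suc n)))"
      using integrable_weight[OF integrable_gauss_scaled integrable_gauss_scaled, of "1 / real (Suc n)" "1 / real (Suc n)"]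
      by simp
    then have "integrable lborel (\<lambda>w. gauss (fst w / real (Suc n)) * gauss (snd w / real (Suc n)) * (LINT p|lborel. norm (h p))\<^sup>2)"
      by simp
    then show "integrable lborel (\<lambda>w. gauss (fst w / real (Suc n)) * gauss (snd w / real (Suc n)) * (norm (qft_L1 h w))\<^sup>2)"
    proof (rule Bochner_Integration.integrable_bound)
      show "(\<lambda>w. gauss (fst w / real (Suc n)) * gauss (snd w / real (Suc n)) * (norm (qft_L1 h w))\<^sup>2) \<in> borel_measurable lborel"
        by measurable
      have "(norm (qft_L1 h w))\<^sup>2 \<le> (LINT p|lborel. norm (h p))\<^sup>2" for w
        by (intro power_mono norm_qft_L1_le) simp
      then show "AE w in lborel. norm (gauss (fst w / real (Suc n)) * gauss (snd w / real (Suc n)) * (norm (qft_L1 h w))\<^sup>2)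
          \<le> norm (gauss (fst w / real (Suc n)) * gauss (snd w / real (Suc n)) * (LINT p|lborel. norm (h p))\<^sup>2)"
        by (auto simp: abs_mult intro!: AE_I2 mult_left_mono)
    qed
  qed (auto intro!: AE_I2 mult_nonneg_nonneg less_imp_le[OF gauss_pos])
  moreover have "(\<lambda>n. ennreal (gaussian_energy h (real (Suc n)))) \<longlonglongrightarrow> ennreal (4 * pi\<^sup>2 * qip h h)"
    by (intro tendsto_ennrealI gaussian_energy_tendsto h1 h2)
  ultimately have eq: "(\<integral>\<^sup>+ w. ennreal ((norm (qft_L1 h w))\<^sup>2) \<partial>lborel) = ennreal (4 * pi\<^sup>2 * qip h h)"
    by (simp add: LIMSEQ_unique)
  have "integrable lborel (\<lambda>w. (norm (qft_L1 h w))\<^sup>2)"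
    by (rule integrableI_nonneg) (use eq in auto)
  then show "qft_L1 h \<in> qL2" by (simp add: qL2_def)
  show "qip (qft_L1 h) (qft_L1 h) = 4 * pi\<^sup>2 * qip h h"
    unfolding qip_self[of "qft_L1 h"]
    by (rule integral_eq_nn_integral[THEN trans]) (simp_all add: eq qip_nonneg)
qed

subsection \<open>The projection onto bandlimited signals\<close>

lemma parseval_L1:
  assumes "f \<in> qL1" "f \<in> qL2" "g \<in> qL1" "g \<in> qL2"
  shows "qip (qft_L1 f) (qft_L1 g) = 4 * pi\<^sup>2 * qip f g"
proof -
  have sum: "(\<lambda>p. f p + g p) \<in> qL1" "(\<lambda>p. f p + g p) \<in> qL2"
    using assms by (auto simp: qL1_def intro: qL2_add)
  note F = plancherel(1)[OF assms(1,2)] plancherel(1)[OF assms(3,4)]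
  have "qft_L1 (\<lambda>p. f p + g p) = (\<lambda>w. qft_L1 f w + qft_L1 g w)"
    using assms by (simp add: qft_L1_add fun_eq_iff)
  with plancherel(2)[OF sum] plancherel(2)[OF assms(1,2)] plancherel(2)[OF assms(3,4)]
  show ?thesis
    using assms F
    by (simp add: qip_simps qip_commute[of g f] qip_commute[of "qft_L1 g" "qft_L1 f"] distrib_left)
qed

section \<open>The transform on \<open>L\<^sup>2\<close> and its inversion\<close>

lemma has_qft_approx:
  assumes "has_qft f \<phi>"
  obtains H where "\<And>n. H n \<in> qL1" "\<And>n. H n \<in> qL2" "qconv H f" "qconv (\<lambda>n. qft_L1 (H n)) \<phi>"
    "f \<in> qL2" "\<phi> \<in> qL2"
proof -
  from assms obtain H where f: "f \<in> qL2" "\<phi> \<in> qL2" and H: "\<And>n. H n \<in> qL1 \<inter> qL2"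
    and l: "(\<lambda>n. \<integral>\<^sup>+ p. ennreal ((norm (H n p - f p))\<^sup>2) \<partial>lborel) \<longlonglongrightarrow> 0"
      "(\<lambda>n. \<integral>\<^sup>+ p. ennreal ((norm (qft_L1 (H n) p - \<phi> p))\<^sup>2) \<partial>lborel) \<longlonglongrightarrow> 0"
    unfolding has_qft_def by auto
  have FH: "qft_L1 (H n) \<in> qL2" for n using H[of n] plancherel(1) by simp
  show thesis
  proof (rule that)
    show "qconv H f" using H f l(1) by (subst qconv_iff_nn_integral) auto
    show "qconv (\<lambda>n. qft_L1 (H n)) \<phi>" using FH f l(2) by (subst qconv_iff_nn_integral) auto
  qed (use H f in auto)
qed

lemma has_qftI:
  assumes "f \<in> qL2" "\<phi> \<in> qL2" "\<And>n. H n \<in> qL1" "\<And>n. H n \<in> qL2"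
    "qconv H f" "qconv (\<lambda>n. qft_L1 (H n)) \<phi>"
  shows "has_qft f \<phi>"
  unfolding has_qft_def
proof (intro conjI assms(1,2) exI[of _ H] allI IntI assms(3,4))
  have FH: "qft_L1 (H n) \<in> qL2" for n using assms(3,4) plancherel(1) by simp
  show "(\<lambda>n. \<integral>\<^sup>+ p. ennreal ((norm (H n p - f p))\<^sup>2) \<partial>lborel) \<longlonglongrightarrow> 0"
    using qconv_iff_nn_integral[of H f] assms by simp
  show "(\<lambda>n. \<integral>\<^sup>+ p. ennreal ((norm (qft_L1 (H n) p - \<phi> p))\<^sup>2) \<partial>lborel) \<longlonglongrightarrow> 0"
    using qconv_iff_nn_integral[of "\<lambda>n. qft_L1 (H n)" \<phi>] FH assms by simp
qed

lemma has_qft_L1: "h \<in> qL1 \<Longrightarrow> h \<in> qL2 \<Longrightarrow> has_qft h (qft_L1 h)"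
  by (rule has_qftI[where H = "\<lambda>_. h"]) (simp_all add: plancherel(1) qconv_const)

theorem has_qft_parseval:
  assumes "has_qft f \<phi>" "has_qft g \<psi>"
  shows "qip \<phi> \<psi> = 4 * pi\<^sup>2 * qip f g"
proof -
  obtain H where H: "\<And>n. H n \<in> qL1" "\<And>n. H n \<in> qL2" "qconv H f" "qconv (\<lambda>n. qft_L1 (H n)) \<phi>"
    "f \<in> qL2" "\<phi> \<in> qL2"
    using assms(1) by (rule has_qft_approx) (rule that)
  obtain G where G: "\<And>n. G n \<in> qL1" "\<And>n. G n \<in> qL2" "qconv G g" "qconv (\<lambda>n. qft_L1 (G n)) \<psi>"
    "g \<in> qL2" "\<psi> \<in> qL2"
    using assms(2) by (rule has_qft_approx) (rule that)
  have "(\<lambda>n. qip (qft_L1 (H n)) (qft_L1 (G n))) \<longlonglongrightarrow> qip \<phi> \<psi>"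
    by (rule qip_tendsto[OF plancherel(1)[OF H(1,2)] H(6,4) plancherel(1)[OF G(1,2)] G(6,4)])
  moreover have "(\<lambda>n. qip (qft_L1 (H n)) (qft_L1 (G n))) \<longlonglongrightarrow> 4 * pi\<^sup>2 * qip f g"
    unfolding parseval_L1[OF H(1,2) G(1,2)]
    by (intro tendsto_mult_left qip_tendsto[OF H(2,5,3) G(2,5,3)])
  ultimately show ?thesis by (rule LIMSEQ_unique)
qed

lemma le_one_plus_square: "a \<le> 1 + a\<^sup>2" for a :: real
  using sum_squares_bound[of a 1] zero_le_power2[of a] unfolding one_power2 mult_1_right by linarith

lemma qL2_bounded_imp_qL1:
  assumes "g \<in> qL2" "bounded A" "A \<in> sets borel" "\<And>p. p \<notin> A \<Longrightarrow> g p = 0"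
  shows "g \<in> qL1"
  unfolding qL1_def mem_Collect_eq
proof (rule Bochner_Integration.integrable_bound)
  show "integrable lborel (\<lambda>p. indicator A p + (norm (g p))\<^sup>2)"
    using assms by (intro Bochner_Integration.integrable_add qL2_integrable_square integrable_indicator_bounded)
  show "g \<in> borel_measurable lborel" using assms by measurable
  have "norm (g p) \<le> norm (indicator A p + (norm (g p))\<^sup>2)" for p
    by (cases "p \<in> A") (auto simp: assms(4) le_one_plus_square order_trans[OF le_one_plus_square abs_ge_self])
  then show "AE p in lborel. norm (g p) \<le> norm (indicator A p + (norm (g p))\<^sup>2)" by (intro AE_I2)
qed

lemma
  fixes f :: "'a::euclidean_space \<Rightarrow> 'b::{banach, second_countable_topology}"
  assumes [measurable]: "f \<in> borel_measurable borel"
  shows integral_lborel_uminus: "(LINT x|lborel. f (- x)) = (LINT x|lborel. f x)"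
    and integrable_lborel_uminus_iff: "integrable lborel (\<lambda>x. f (- x)) \<longleftrightarrow> integrable lborel f"
proof -
  have eq: "(lborel :: 'a measure) = distr lborel borel (\<lambda>x. - x)"
    using lborel_affine[of "-1" "0::'a"] by (simp add: density_1)
  show "(LINT x|lborel. f (- x)) = (LINT x|lborel. f x)"
    by (subst (2) eq, subst integral_distr) auto
  show "integrable lborel (\<lambda>x. f (- x)) \<longleftrightarrow> integrable lborel f"
    by (subst (2) eq, subst integrable_distr_eq) auto
qed

definition qidft :: "(real \<times> real \<Rightarrow> quat) \<Rightarrow> real \<times> real \<Rightarrow> quat" where
  "qidft \<phi> p = (1 / (4 * pi\<^sup>2)) *\<^sub>R qft_L1 \<phi> (- p)"

text \<open>The inverse transform \<open>qidft \<phi>\<close> need not be integrable, so it is cut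
  off to balls, giving \<open>H n\<close>. Transfer evaluates the mixed term, and the squared
  distance of \<open>qft_L1 (H n)\<close> from \<open>\<phi>\<close> becomes the energy of
  \<open>\<phi>\<close> minus \<open>4 * pi\<^sup>2\<close> times that of \<open>H n\<close>. It
  tends to 0 because Plancherel for \<open>\<phi>\<close> fixes the energy of
  \<open>qidft \<phi>\<close>.\<close>

lemma has_qft_qidft:
  assumes L: "\<phi> \<in> qL1" "\<phi> \<in> qL2"
  shows "has_qft (qidft \<phi>) \<phi>"
proof -
  note P = plancherel[OF L]
  have [measurable]: "qft_L1 \<phi> \<in> borel_measurable borel" by (rule qft_L1_measurable[OF L(1)])
  define r where "r = (\<lambda>p. qft_L1 \<phi> (- p))"
  have rm [measurable]: "r \<in> borel_measurable borel" unfolding r_def by measurable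
  have "integrable lborel (\<lambda>p. (norm (r p))\<^sup>2)"
    unfolding r_def using integrable_lborel_uminus_iff[of "\<lambda>p. (norm (qft_L1 \<phi> p))\<^sup>2"]
      qL2_integrable_square[OF P(1)] by simp
  then have rL: "r \<in> qL2" by (simp add: qL2_def)
  have rr: "qip r r = 4 * pi\<^sup>2 * qip \<phi> \<phi>"
    using integral_lborel_uminus[of "\<lambda>p. (norm (qft_L1 \<phi> p))\<^sup>2"] P(2)
    by (simp add: r_def qip_self)
  have s_def: "qidft \<phi> = (\<lambda>p. (1 / (4 * pi\<^sup>2)) *\<^sub>R r p)"
    by (simp add: qidft_def[abs_def] r_def)
  have sL: "qidft \<phi> \<in> qL2" unfolding s_def by (rule qL2_scaleR[OF rL])
  define H where "H = (\<lambda>n::nat. \<lambda>p. indicator (cball 0 (real n)) p *\<^sub>R qidft \<phi> p)"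
  have HL: "H n \<in> qL2" for n unfolding H_def by (rule qL2_indicator[OF sL]) simp
  have H1: "H n \<in> qL1" for n
    by (rule qL2_bounded_imp_qL1[OF HL, of "cball 0 (real n)"]) (auto simp: H_def)
  have conv: "qconv H (qidft \<phi>)"
  proof (rule qconv_dominated[OF HL sL qL2_integrable_square[OF sL]])
    have "(\<lambda>n. H n p) \<longlonglongrightarrow> qidft \<phi> p" for p
    proof (rule tendsto_eventually)
      obtain N :: nat where "norm p \<le> real N" using real_arch_simple by auto
      then show "\<forall>\<^sub>F n in sequentially. H n p = qidft \<phi> p"
        unfolding eventually_sequentially by (intro exI[of _ N]) (auto simp: H_def)
    qed
    then show "AE p in lborel. (\<lambda>n. H n p) \<longlonglongrightarrow> qidft \<phi> p" by (intro AE_I2)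
    show "AE p in lborel. (norm (H n p - qidft \<phi> p))\<^sup>2 \<le> (norm (qidft \<phi> p))\<^sup>2" for n
      by (intro AE_I2) (auto simp: H_def indicator_def)
  qed
  have "qip (\<lambda>w. qft_L1 (H n) w - \<phi> w) (\<lambda>w. qft_L1 (H n) w - \<phi> w) = qip \<phi> \<phi> - 4 * pi\<^sup>2 * qip (H n) (H n)" for n
  proof -
    have "qip (qft_L1 (H n)) \<phi> = qip (H n) r"
      unfolding qip_def r_def by (rule qft_L1_transfer[OF H1 L(1)])
    also have "\<dots> = 4 * pi\<^sup>2 * qip (H n) (qidft \<phi>)"
      unfolding s_def qip_scaleR_right by simp
    also have "qip (H n) (qidft \<phi>) = qip (H n) (H n)"
      unfolding qip_def by (rule Bochner_Integration.integral_cong) (auto simp: H_def indicator_def)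
    finally show ?thesis
      using plancherel[OF H1 HL, of n] L
      by (simp add: qip_simps qip_commute[of \<phi> "qft_L1 (H n)"])
  qed
  moreover have "(\<lambda>n. qip \<phi> \<phi> - 4 * pi\<^sup>2 * qip (H n) (H n)) \<longlonglongrightarrow> qip \<phi> \<phi> - 4 * pi\<^sup>2 * qip (qidft \<phi>) (qidft \<phi>)"
    by (intro tendsto_diff tendsto_const tendsto_mult_left qip_tendsto[OF HL sL conv HL sL conv])
  moreover have "4 * pi\<^sup>2 * qip (qidft \<phi>) (qidft \<phi>) = qip \<phi> \<phi>"
    unfolding s_def qip_scaleR_left qip_scaleR_right rr by simp
  ultimately have "qconv (\<lambda>n. qft_L1 (H n)) \<phi>"
    unfolding qconv_def by simp
  then show ?thesis by (rule has_qftI[OF sL L(2) H1 HL conv])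
qed

section \<open>The sinc operator as a frequency cutoff\<close>

definition sinc_op :: "real \<Rightarrow> real \<Rightarrow> (real \<times> real \<Rightarrow> quat) \<Rightarrow> real \<times> real \<Rightarrow> quat" where
  "sinc_op w1 w2 g p =
     (LINT q|lborel. (sinc_kernel w1 (fst p - fst q) * sinc_kernel w2 (snd p - snd q)) *\<^sub>R g q)"

lemma sinc_kernel_minus: "sinc_kernel w (x - y) = sinc_kernel w (y - x)"
proof (cases "x = y")
  case False
  have "sin (w * (x - y)) = - sin (w * (y - x))"
    by (metis minus_diff_eq mult_minus_right sin_minus)
  moreover have "pi * (x - y) = - (pi * (y - x))" by (simp add: algebra_simps)
  ultimately show ?thesis using False by (simp add: sinc_kernel_def)
qed simp

lemma cos_transform_indicator:
  assumes "w \<ge> 0"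
  shows "cos_transform (indicator {- w..w}) x = 2 * pi * sinc_kernel w x"
proof (cases "x = 0")
  case True
  then show ?thesis using assms by (simp add: cos_transform_def sinc_kernel_def)
next
  case False
  have "(LINT u|lborel. cos (x * u) * indicator {- w..w} u) = sin (x * w) / x - sin (x * (- w)) / x"
    by (rule integral_FTC_Icc_real) (use False assms in \<open>auto intro!: derivative_eq_intros\<close>)
  then show ?thesis using False by (simp add: cos_transform_def sinc_kernel_def mult.commute)
qed

text \<open>The multiplier formula with indicators of intervals as weights: each cosine transform is
  \<open>2 * pi\<close> times a sinc kernel, and the product of these constants cancels the
  normalization of \<open>qidft\<close>.\<close>

lemma sinc_op_eq_qidft:
  assumes "g \<in> qL1" "w1 \<ge> 0" "w2 \<ge> 0"
  shows "sinc_op w1 w2 g = qidft (\<lambda>w. indicator (rect w1 w2) w *\<^sub>R qft_L1 g w)"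
proof
  fix p
  have ind: "indicator (rect w1 w2) w = (indicator {- w1..w1} (fst w) * indicator {- w2..w2} (snd w) :: real)" for w
    by (cases w) (auto simp: rect_def indicator_def)
  have I: "integrable lborel (indicator {- w..w} :: real \<Rightarrow> real)" for w
    by (rule integrable_indicator_bounded) auto
  have "qft_L1 (\<lambda>w. indicator (rect w1 w2) w *\<^sub>R qft_L1 g w) (- p) =
    (LINT q|lborel. (cos_transform (indicator {- w1..w1}) (fst q - fst p) *
       cos_transform (indicator {- w2..w2}) (snd q - snd p)) *\<^sub>R g q)"
    unfolding ind by (rule qft_L1_multiplier[OF assms(1) I I]) (auto simp: indicator_def)
  also have "\<dots> = (LINT q|lborel. (4 * pi\<^sup>2) *\<^sub>R ((sinc_kernel w1 (fst p - fst q) * sinc_kernel w2 (snd p - snd q)) *\<^sub>R g q))"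
    by (simp add: cos_transform_indicator assms sinc_kernel_minus[of _ "fst p"] sinc_kernel_minus[of _ "snd p"]
        power2_eq_square mult_ac)
  finally show "sinc_op w1 w2 g p = qidft (\<lambda>w. indicator (rect w1 w2) w *\<^sub>R qft_L1 g w) p"
    unfolding integral_scaleR_right by (simp add: sinc_op_def qidft_def)
qed

lemma rect_borel [measurable, simp]: "rect w1 w2 \<in> sets borel"
  and bounded_rect: "bounded (rect w1 w2)"
  and compact_rect: "compact (rect w1 w2)"
proof -
  show c: "compact (rect w1 w2)" unfolding rect_def by (intro compact_Times compact_Icc)
  show "rect w1 w2 \<in> sets borel" using compact_imp_closed[OF c] by (rule borel_closed)
  show "bounded (rect w1 w2)" using c by (rule compact_imp_bounded)
qed

lemma has_qft_sinc_op:
  assumes g: "g \<in> qL1" "g \<in> qL2" and w: "w1 \<ge> 0" "w2 \<ge> 0"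
  shows "has_qft (sinc_op w1 w2 g) (\<lambda>w. indicator (rect w1 w2) w *\<^sub>R qft_L1 g w)"
proof -
  have L2: "(\<lambda>w. indicator (rect w1 w2) w *\<^sub>R qft_L1 g w) \<in> qL2"
    by (rule qL2_indicator[OF plancherel(1)[OF g]]) simp
  show ?thesis
    unfolding sinc_op_eq_qidft[OF g(1) w]
    by (rule has_qft_qidft[OF qL2_bounded_imp_qL1[OF L2 bounded_rect[of w1 w2] rect_borel] L2]) simp
qed

lemma sinc_op_qL2:
  "g \<in> qL1 \<Longrightarrow> g \<in> qL2 \<Longrightarrow> w1 \<ge> 0 \<Longrightarrow> w2 \<ge> 0 \<Longrightarrow> sinc_op w1 w2 g \<in> qL2"
  using has_qft_sinc_op[of g w1 w2] by (simp add: has_qft_def)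

lemma sinc_op_bandlimited:
  assumes "g \<in> qL1" "g \<in> qL2" "w1 \<ge> 0" "w2 \<ge> 0"
  shows "sinc_op w1 w2 g \<in> bandlimited (rect w1 w2)"
  unfolding bandlimited_def using has_qft_sinc_op[OF assms] by auto

lemma bandlimited_qL2: "f \<in> bandlimited W \<Longrightarrow> f \<in> qL2"
  by (auto simp: bandlimited_def has_qft_def)

text \<open>After Parseval on both sides, the cutoff to the frequency rectangle is absorbed by the
  transform of \<open>f\<close>, which vanishes outside it.\<close>

lemma qip_bandlimited:
  assumes f: "f \<in> bandlimited (rect w1 w2)" and g: "g \<in> qL1" "g \<in> qL2" and w: "w1 \<ge> 0" "w2 \<ge> 0"
  shows "qip (sinc_op w1 w2 g) f = qip g f"
proof -
  obtain \<phi> where \<phi>: "has_qft f \<phi>" and ae: "AE p in lborel. p \<notin> rect w1 w2 \<longrightarrow> \<phi> p = 0"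
    using f by (auto simp: bandlimited_def)
  have [measurable]: "\<phi> \<in> borel_measurable borel" using \<phi> by (auto simp: has_qft_def qL2_def)
  have [measurable]: "qft_L1 g \<in> borel_measurable borel" by (rule qft_L1_measurable[OF g(1)])
  have "4 * pi\<^sup>2 * qip (sinc_op w1 w2 g) f = qip (\<lambda>w. indicator (rect w1 w2) w *\<^sub>R qft_L1 g w) \<phi>"
    by (rule has_qft_parseval[OF has_qft_sinc_op[OF g w] \<phi>, symmetric])
  also have "\<dots> = qip (qft_L1 g) \<phi>"
    unfolding qip_def
  proof (rule integral_cong_AE)
    show "AE p in lborel. inner (indicator (rect w1 w2) p *\<^sub>R qft_L1 g p) (\<phi> p) = inner (qft_L1 g p) (\<phi> p)"
      using ae by eventually_elim (auto simp: indicator_def)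
  qed measurable
  also have "\<dots> = 4 * pi\<^sup>2 * qip g f"
    by (rule has_qft_parseval[OF has_qft_L1[OF g] \<phi>])
  finally show ?thesis by simp
qed

subsection \<open>Estimates for the sinc kernel\<close>

text \<open>The integral representation makes the removable singularity invisible; the bounds below
  come from estimating the cosine under the integral.\<close>

lemma sinc_kernel_eq_cos_transform:
  "w \<ge> 0 \<Longrightarrow> sinc_kernel w x = cos_transform (indicator {- w..w}) x / (2 * pi)"
  by (simp add: cos_transform_indicator)

lemma integrable_indicator_Icc: "integrable lborel (indicator {a..b} :: real \<Rightarrow> real)"
  by (rule integrable_indicator_bounded) auto

lemma abs_sinc_kernel_le:
  assumes "w \<ge> 0"
  shows "\<bar>sinc_kernel w x\<bar> \<le> w / pi"
proof -
  have "\<bar>cos_transform (indicator {- w..w}) x\<bar> \<le> (LINT u|lborel. indicator {- w..w} u)"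
    unfolding cos_transform_def
    by (rule integral_abs_bound_integral[OF integrable_trig_mult(1)[OF integrable_indicator_Icc]
          integrable_indicator_Icc]) (simp add: abs_mult indicator_def)
  then show ?thesis
    using assms by (simp add: sinc_kernel_eq_cos_transform abs_mult field_simps)
qed

lemma sinc_kernel_lipschitz:
  assumes "w \<ge> 0"
  shows "\<bar>sinc_kernel w x - sinc_kernel w y\<bar> \<le> (w\<^sup>2 / pi) * \<bar>x - y\<bar>"
proof -
  \<comment> \<open>On the interval \<open>\<bar>u\<bar> \<le> w\<close>, so the cosines differ by
    at most \<open>w * \<bar>x - y\<bar>\<close>; the length \<open>2 * w\<close> and the factor
    \<open>2 * pi\<close> then give \<open>w\<^sup>2 / pi\<close>.\<close>
  have "\<bar>LINT u|lborel. cos (x * u) * indicator {- w..w} u - cos (y * u) * indicator {- w..w} u\<bar>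
      \<le> (LINT u|lborel. (w * \<bar>x - y\<bar>) * indicator {- w..w} u)"
  proof (rule integral_abs_bound_integral)
    show "integrable lborel (\<lambda>u. cos (x * u) * indicator {- w..w} u - cos (y * u) * indicator {- w..w} u)"
      by (intro Bochner_Integration.integrable_diff integrable_trig_mult integrable_indicator_Icc)
    show "integrable lborel (\<lambda>u. (w * \<bar>x - y\<bar>) * indicator {- w..w} u)"
      by (intro integrable_mult_right integrable_indicator_Icc)
    fix u :: real
    have cos_le: "\<bar>cos a - cos b\<bar> \<le> \<bar>a - b\<bar>" for a b :: real
    proof -
      have "\<bar>cos a - cos b\<bar> = 2 * (\<bar>sin ((a + b) / 2)\<bar> * \<bar>sin ((b - a) / 2)\<bar>)"
        by (simp add: cos_diff_cos abs_mult)
      also have "\<dots> \<le> 2 * (1 * \<bar>(b - a) / 2\<bar>)"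
        by (intro mult_left_mono mult_mono abs_sin_le_one abs_sin_x_le_abs_x) auto
      finally show ?thesis by simp
    qed
    show "\<bar>cos (x * u) * indicator {- w..w} u - cos (y * u) * indicator {- w..w} u\<bar>
        \<le> (w * \<bar>x - y\<bar>) * indicator {- w..w} u"
    proof (cases "u \<in> {- w..w}")
      case True
      then have "\<bar>u\<bar> \<le> w" by auto
      then have "\<bar>u\<bar> * \<bar>x - y\<bar> \<le> w * \<bar>x - y\<bar>" by (rule mult_right_mono) simp
      then have "\<bar>x * u - y * u\<bar> \<le> w * \<bar>x - y\<bar>"
        unfolding left_diff_distrib[symmetric] abs_mult by (simp only: mult.commute)
      then show ?thesis using cos_le[of "x * u" "y * u"] True by simp
    qed simp
  qed
  then have "\<bar>cos_transform (indicator {- w..w}) x - cos_transform (indicator {- w..w}) y\<bar>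
      \<le> (w * \<bar>x - y\<bar>) * (2 * w)"
    unfolding cos_transform_def using assms
    by (simp add: Bochner_Integration.integral_diff integrable_trig_mult integrable_indicator_Icc)
  then have "\<bar>2 * pi * sinc_kernel w x - 2 * pi * sinc_kernel w y\<bar> \<le> (w * \<bar>x - y\<bar>) * (2 * w)"
    using assms by (simp add: cos_transform_indicator)
  then have "2 * pi * \<bar>sinc_kernel w x - sinc_kernel w y\<bar> \<le> (w * \<bar>x - y\<bar>) * (2 * w)"
    by (simp add: abs_mult flip: right_diff_distrib)
  then show ?thesis by (simp add: field_simps power2_eq_square)
qed

text \<open>Positivity on the main lobe will show that some time-limited signal has positive
  concentration.\<close>

lemma sinc_kernel_pos:
  assumes "w > 0" "\<bar>w * x\<bar> < pi"
  shows "sinc_kernel w x > 0"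
proof -
  have pos: "sinc_kernel w y > 0" if "y > 0" "w * y < pi" for y
    using that assms(1) by (simp add: sinc_kernel_def sin_gt_zero)
  consider "x = 0" | "x > 0" | "x < 0" by linarith
  then show ?thesis
  proof cases
    case 1
    then show ?thesis using assms by (simp add: sinc_kernel_def)
  next
    case 2
    then show ?thesis using pos[of x] assms by simp
  next
    case 3
    then show ?thesis
      using pos[of "- x"] assms sinc_kernel_minus[of w 0 x] by (simp add: abs_less_iff)
  qed
qed

definition sinc2 :: "real \<Rightarrow> real \<Rightarrow> real \<times> real \<Rightarrow> real" where
  "sinc2 w1 w2 z = sinc_kernel w1 (fst z) * sinc_kernel w2 (snd z)"

lemma sinc_op_eq: "sinc_op w1 w2 g p = (LINT q|lborel. sinc2 w1 w2 (p - q) *\<^sub>R g q)"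
  by (simp add: sinc_op_def sinc2_def)

lemma measurable_sinc_kernel [measurable]: "sinc_kernel w \<in> borel_measurable borel"
  unfolding sinc_kernel_def[abs_def] by measurable

lemma measurable_sinc2 [measurable]: "sinc2 w1 w2 \<in> borel_measurable borel"
  unfolding sinc2_def[abs_def] by measurable

lemma abs_sinc2_le:
  assumes "w1 \<ge> 0" "w2 \<ge> 0"
  shows "\<bar>sinc2 w1 w2 z\<bar> \<le> w1 * w2 / pi\<^sup>2"
proof -
  have "\<bar>sinc2 w1 w2 z\<bar> \<le> (w1 / pi) * (w2 / pi)"
    unfolding sinc2_def abs_mult using assms by (intro mult_mono abs_sinc_kernel_le) auto
  then show ?thesis by (simp add: power2_eq_square)
qed

lemma sinc2_lipschitz:
  assumes "w1 \<ge> 0" "w2 \<ge> 0"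
  shows "\<bar>sinc2 w1 w2 z - sinc2 w1 w2 z'\<bar> \<le> (w1 * w2 * (w1 + w2) / pi\<^sup>2) * norm (z - z')"
proof -
  have "\<bar>sinc2 w1 w2 z - sinc2 w1 w2 z'\<bar>
      = \<bar>(sinc_kernel w1 (fst z) - sinc_kernel w1 (fst z')) * sinc_kernel w2 (snd z)
        + sinc_kernel w1 (fst z') * (sinc_kernel w2 (snd z) - sinc_kernel w2 (snd z'))\<bar>"
    by (simp add: sinc2_def algebra_simps)
  also have "\<dots> \<le> \<bar>sinc_kernel w1 (fst z) - sinc_kernel w1 (fst z')\<bar> * \<bar>sinc_kernel w2 (snd z)\<bar>
        + \<bar>sinc_kernel w1 (fst z')\<bar> * \<bar>sinc_kernel w2 (snd z) - sinc_kernel w2 (snd z')\<bar>"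
    using abs_triangle_ineq by (simp add: abs_mult[symmetric])
  also have "\<dots> \<le> ((w1\<^sup>2 / pi) * norm (z - z')) * (w2 / pi) + (w1 / pi) * ((w2\<^sup>2 / pi) * norm (z - z'))"
  proof (intro add_mono mult_mono abs_sinc_kernel_le assms)
    have d: "\<bar>fst z - fst z'\<bar> \<le> norm (z - z')" "\<bar>snd z - snd z'\<bar> \<le> norm (z - z')"
      using norm_fst_le[of "fst (z - z')" "snd (z - z')"] norm_snd_le[of "snd (z - z')" "fst (z - z')"]
      by (simp_all add: minus_prod_def)
    show "\<bar>sinc_kernel w1 (fst z) - sinc_kernel w1 (fst z')\<bar> \<le> (w1\<^sup>2 / pi) * norm (z - z')"
      by (rule order_trans[OF sinc_kernel_lipschitz[OF assms(1)] mult_left_mono[OF d(1)]]) simp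
    show "\<bar>sinc_kernel w2 (snd z) - sinc_kernel w2 (snd z')\<bar> \<le> (w2\<^sup>2 / pi) * norm (z - z')"
      by (rule order_trans[OF sinc_kernel_lipschitz[OF assms(2)] mult_left_mono[OF d(2)]]) simp
  qed (use assms in auto)
  also have "\<dots> = (w1 * w2 * (w1 + w2) / pi\<^sup>2) * norm (z - z')"
    by (simp add: field_simps power2_eq_square)
  finally show ?thesis .
qed

lemma sinc_op_integrable:
  assumes "g \<in> qL1" "w1 \<ge> 0" "w2 \<ge> 0"
  shows "integrable lborel (\<lambda>q. sinc2 w1 w2 (p - q) *\<^sub>R g q)"
proof (rule Bochner_Integration.integrable_bound)
  show "integrable lborel (\<lambda>q. (w1 * w2 / pi\<^sup>2) *\<^sub>R g q)"
    using assms(1) by (simp add: qL1_def)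
  show "(\<lambda>q. sinc2 w1 w2 (p - q) *\<^sub>R g q) \<in> borel_measurable lborel"
    using assms(1) by measurable
  have "norm (sinc2 w1 w2 (p - q) *\<^sub>R g q) \<le> norm ((w1 * w2 / pi\<^sup>2) *\<^sub>R g q)" for q
    using mult_right_mono[OF abs_sinc2_le[OF assms(2,3), of "p - q"] norm_ge_zero[of "g q"]] assms(2,3)
    by simp
  then show "AE q in lborel. norm (sinc2 w1 w2 (p - q) *\<^sub>R g q) \<le> norm ((w1 * w2 / pi\<^sup>2) *\<^sub>R g q)"
    by (intro AE_I2)
qed

lemma sinc_op_add_scaleR:
  assumes "f \<in> qL1" "g \<in> qL1" "w1 \<ge> 0" "w2 \<ge> 0"
  shows "sinc_op w1 w2 (\<lambda>p. f p + c *\<^sub>R g p) = (\<lambda>p. sinc_op w1 w2 f p + c *\<^sub>R sinc_op w1 w2 g p)"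
proof
  fix p
  have "sinc2 w1 w2 (p - q) *\<^sub>R (f q + c *\<^sub>R g q)
      = sinc2 w1 w2 (p - q) *\<^sub>R f q + c *\<^sub>R (sinc2 w1 w2 (p - q) *\<^sub>R g q)" for q
    by (simp add: algebra_simps)
  then show "sinc_op w1 w2 (\<lambda>p. f p + c *\<^sub>R g p) p = sinc_op w1 w2 f p + c *\<^sub>R sinc_op w1 w2 g p"
    unfolding sinc_op_eq using assms
    by (simp add: sinc_op_integrable del: scaleR_scaleR)
qed

lemma sinc_op_scaleR: "sinc_op w1 w2 (\<lambda>p. c *\<^sub>R g p) = (\<lambda>p. c *\<^sub>R sinc_op w1 w2 g p)"
  unfolding sinc_op_eq by (rule ext, subst integral_scaleR_right[symmetric]) (simp add: mult.commute)

lemma norm_sinc_op_le: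
  assumes "g \<in> qL1" "w1 \<ge> 0" "w2 \<ge> 0"
  shows "norm (sinc_op w1 w2 g p) \<le> w1 * w2 / pi\<^sup>2 * (LINT q|lborel. norm (g q))"
proof -
  have "norm (sinc_op w1 w2 g p) \<le> (LINT q|lborel. (w1 * w2 / pi\<^sup>2) * norm (g q))"
    unfolding sinc_op_eq
  proof (rule Bochner_Integration.integral_norm_bound_integral[OF sinc_op_integrable[OF assms]])
    show "integrable lborel (\<lambda>q. (w1 * w2 / pi\<^sup>2) * norm (g q))" using assms by (simp add: qL1_def)
    show "norm (sinc2 w1 w2 (p - q) *\<^sub>R g q) \<le> (w1 * w2 / pi\<^sup>2) * norm (g q)" for q
      using mult_right_mono[OF abs_sinc2_le[OF assms(2,3), of "p - q"] norm_ge_zero[of "g q"]] by simp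
  qed
  then show ?thesis by simp
qed

lemma sinc_op_lipschitz:
  assumes "g \<in> qL1" "w1 \<ge> 0" "w2 \<ge> 0"
  shows "norm (sinc_op w1 w2 g p - sinc_op w1 w2 g p')
    \<le> (w1 * w2 * (w1 + w2) / pi\<^sup>2) * norm (p - p') * (LINT q|lborel. norm (g q))"
proof -
  let ?L = "(w1 * w2 * (w1 + w2) / pi\<^sup>2) * norm (p - p')"
  have "norm (sinc_op w1 w2 g p - sinc_op w1 w2 g p')
      = norm (LINT q|lborel. sinc2 w1 w2 (p - q) *\<^sub>R g q - sinc2 w1 w2 (p' - q) *\<^sub>R g q)"
    unfolding sinc_op_eq by (simp add: Bochner_Integration.integral_diff sinc_op_integrable assms)
  also have "\<dots> \<le> (LINT q|lborel. ?L * norm (g q))"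
  proof (rule Bochner_Integration.integral_norm_bound_integral)
    show "integrable lborel (\<lambda>q. sinc2 w1 w2 (p - q) *\<^sub>R g q - sinc2 w1 w2 (p' - q) *\<^sub>R g q)"
      by (intro Bochner_Integration.integrable_diff sinc_op_integrable assms)
    show "integrable lborel (\<lambda>q. ?L * norm (g q))" using assms by (simp add: qL1_def)
    fix q
    have "norm (sinc2 w1 w2 (p - q) *\<^sub>R g q - sinc2 w1 w2 (p' - q) *\<^sub>R g q)
        = \<bar>sinc2 w1 w2 (p - q) - sinc2 w1 w2 (p' - q)\<bar> * norm (g q)"
      by (simp flip: scaleR_diff_left)
    also have "\<dots> \<le> ?L * norm (g q)"
      using sinc2_lipschitz[OF assms(2,3), of "p - q" "p' - q"] by (intro mult_right_mono) auto
    finally show "norm (sinc2 w1 w2 (p - q) *\<^sub>R g q - sinc2 w1 w2 (p' - q) *\<^sub>R g q) \<le> ?L * norm (g q)" .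
  qed
  also have "\<dots> = ?L * (LINT q|lborel. norm (g q))" by simp
  finally show ?thesis .
qed

section \<open>Null sets and reformulation of the notions through \<open>qip\<close>\<close>

lemma has_qft_cong_AE:
  assumes "has_qft f \<phi>" "f' \<in> qL2" "AE p in lborel. f' p = f p"
  shows "has_qft f' \<phi>"
proof -
  have "(\<integral>\<^sup>+ p. ennreal ((norm (h p - f' p))\<^sup>2) \<partial>lborel) = (\<integral>\<^sup>+ p. ennreal ((norm (h p - f p))\<^sup>2) \<partial>lborel)" for h
    by (rule nn_integral_cong_AE) (use assms(3) in eventually_elim, simp)
  with assms(1,2) show ?thesis unfolding has_qft_def by simp
qed

text \<open>An eigenfunction agrees with a multiple of its sinc image only almost everywhere, so
  \<open>bandlimited\<close> has to survive such a change.\<close>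

lemma bandlimited_cong_AE:
  "f \<in> bandlimited W \<Longrightarrow> f' \<in> qL2 \<Longrightarrow> AE p in lborel. f' p = f p \<Longrightarrow> f' \<in> bandlimited W"
  unfolding bandlimited_def using has_qft_cong_AE by blast

lemma nonzero_iff_qip: "f \<in> qL2 \<Longrightarrow> nonzero f \<longleftrightarrow> qip f f > 0"
  using qip_self_eq_0_iff[of f] qip_nonneg[of f] by (auto simp: nonzero_def)

lemma energy_ratio_eq:
  "energy_ratio T f = qip (\<lambda>p. indicator T p *\<^sub>R f p) (\<lambda>p. indicator T p *\<^sub>R f p) / qip f f"
proof -
  have "(LINT p:T|lborel. (norm (f p))\<^sup>2) = qip (\<lambda>p. indicator T p *\<^sub>R f p) (\<lambda>p. indicator T p *\<^sub>R f p)"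
    unfolding qip_self set_lebesgue_integral_def
    by (rule Bochner_Integration.integral_cong) (auto simp: indicator_def)
  then show ?thesis by (simp add: energy_ratio_def qip_self)
qed

lemma eigenfunction_iff:
  "eigenfunction T w1 w2 \<mu> f \<longleftrightarrow> f \<in> qL2 \<and> nonzero f \<and>
     (AE p in lborel. sinc_op w1 w2 (\<lambda>q. indicator T q *\<^sub>R f q) p = \<mu> *\<^sub>R f p)"
  unfolding eigenfunction_def sinc_op_def set_lebesgue_integral_def case_prod_unfold
  by (simp add: mult.commute[of "indicator T _"])

subsection \<open>Energy concentration\<close>

locale concentration =
  fixes \<tau> w1 w2 :: real
  assumes tau_pos: "\<tau> > 0" and w1_pos: "w1 > 0" and w2_pos: "w2 > 0"
begin

abbreviation T where "T \<equiv> rect \<tau> \<tau>"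

definition cut :: "(real \<times> real \<Rightarrow> quat) \<Rightarrow> real \<times> real \<Rightarrow> quat" where
  "cut f = (\<lambda>p. indicator T p *\<^sub>R f p)"

text \<open>The support condition is pointwise, as \<open>cut\<close> delivers it; this lets
  integrals over the plane be rewritten without null sets.\<close>

definition time_limited :: "(real \<times> real \<Rightarrow> quat) set" where
  "time_limited = {g \<in> qL2. \<forall>p. p \<notin> T \<longrightarrow> g p = 0}"

abbreviation K where "K \<equiv> sinc_op w1 w2"

lemma w_nonneg: "w1 \<ge> 0" "w2 \<ge> 0"
  using w1_pos w2_pos by simp_all

lemma time_limited_qL2: "g \<in> time_limited \<Longrightarrow> g \<in> qL2"
  by (simp add: time_limited_def)

lemma time_limited_zero: "g \<in> time_limited \<Longrightarrow> p \<notin> T \<Longrightarrow> g p = 0"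
  unfolding time_limited_def by blast

lemma time_limited_qL1: "g \<in> time_limited \<Longrightarrow> g \<in> qL1"
  by (rule qL2_bounded_imp_qL1[OF time_limited_qL2 bounded_rect[of \<tau> \<tau>] rect_borel]) (auto simp: time_limited_def)

lemma time_limited_cut: "f \<in> qL2 \<Longrightarrow> cut f \<in> time_limited"
  unfolding cut_def time_limited_def using qL2_indicator[OF _ rect_borel] by simp

lemma time_limited_add_scaleR: "g \<in> time_limited \<Longrightarrow> h \<in> time_limited \<Longrightarrow> (\<lambda>p. g p + c *\<^sub>R h p) \<in> time_limited"
  by (auto simp: time_limited_def intro: qL2_add qL2_scaleR)

lemma time_limited_scaleR: "h \<in> time_limited \<Longrightarrow> (\<lambda>p. c *\<^sub>R h p) \<in> time_limited"
  by (auto simp: time_limited_def intro: qL2_scaleR)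

lemma K_qL2: "g \<in> time_limited \<Longrightarrow> K g \<in> qL2"
  by (intro sinc_op_qL2 time_limited_qL1 time_limited_qL2 w_nonneg)

lemma K_bandlimited: "g \<in> time_limited \<Longrightarrow> K g \<in> bandlimited (rect w1 w2)"
  by (intro sinc_op_bandlimited time_limited_qL1 time_limited_qL2 w_nonneg)

lemma qip_K: "f \<in> bandlimited (rect w1 w2) \<Longrightarrow> g \<in> time_limited \<Longrightarrow> qip (K g) f = qip g f"
  by (intro qip_bandlimited time_limited_qL1 time_limited_qL2 w_nonneg)

lemma qip_cut: "g \<in> time_limited \<Longrightarrow> qip g (cut f) = qip g f"
  unfolding qip_def by (rule Bochner_Integration.integral_cong) (auto simp: cut_def time_limited_def indicator_def)

lemma qip_cut_left: "g \<in> time_limited \<Longrightarrow> qip (cut f) g = qip f g"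
  using qip_cut[of g f] by (simp add: qip_commute)

section \<open>The concentration form and its supremum\<close>

definition conc :: "(real \<times> real \<Rightarrow> quat) \<Rightarrow> (real \<times> real \<Rightarrow> quat) \<Rightarrow> real" where
  "conc g h = qip (K g) (K h)"

lemma conc_eq: "g \<in> time_limited \<Longrightarrow> h \<in> time_limited \<Longrightarrow> conc g h = qip (K g) h"
  unfolding conc_def using qip_K[OF K_bandlimited[of g], of h] by (simp add: qip_commute)

lemma conc_commute: "conc g h = conc h g"
  by (simp add: conc_def qip_commute)

lemma conc_nonneg: "conc g g \<ge> 0"
  by (simp add: conc_def qip_nonneg)

text \<open>The energy of \<open>K g\<close> equals \<open>qip (K g) g\<close>, so Cauchy-Schwarz
  makes \<open>K\<close> a contraction; this also bounds the supremum below by 1.\<close>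

lemma conc_le:
  assumes "g \<in> time_limited"
  shows "conc g g \<le> qip g g"
proof (cases "conc g g = 0")
  case False
  then have pos: "conc g g > 0" using conc_nonneg[of g] by simp
  have "(conc g g)\<^sup>2 \<le> conc g g * qip g g"
    using qip_Cauchy_Schwarz[OF K_qL2 time_limited_qL2, OF assms assms] conc_eq[OF assms assms]
    by (simp add: conc_def)
  then show ?thesis using pos by (simp add: power2_eq_square)
qed (simp add: qip_nonneg)

lemma conc_add_scaleR:
  assumes "g \<in> time_limited" "h \<in> time_limited"
  shows "conc (\<lambda>p. g p + c *\<^sub>R h p) (\<lambda>p. g p + c *\<^sub>R h p) = conc g g + 2 * c * conc g h + c\<^sup>2 * conc h h"
  unfolding conc_def sinc_op_add_scaleR[OF time_limited_qL1 time_limited_qL1 w_nonneg, OF assms]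
  using K_qL2[OF assms(1)] K_qL2[OF assms(2)]
  by (simp add: qip_simps qip_commute[of "K h" "K g"] algebra_simps power2_eq_square)

lemma conc_scaleR: "conc (\<lambda>p. c *\<^sub>R g p) (\<lambda>p. c *\<^sub>R g p) = c\<^sup>2 * conc g g"
  by (simp add: conc_def sinc_op_scaleR qip_scaleR_left qip_scaleR_right power2_eq_square)

definition \<Lambda> :: real where
  "\<Lambda> = (SUP g\<in>{g \<in> time_limited. qip g g = 1}. conc g g)"

lemma bdd_conc: "bdd_above ((\<lambda>g. conc g g) ` {g \<in> time_limited. qip g g = 1})"
  by (rule bdd_aboveI[of _ 1]) (use conc_le in fastforce)

lemma normalize_time_limited:
  assumes "g \<in> time_limited" "qip g g > 0"
  defines "h \<equiv> \<lambda>p. (1 / sqrt (qip g g)) *\<^sub>R g p"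
  shows "h \<in> {g \<in> time_limited. qip g g = 1}" "conc h h = conc g g / qip g g"
  using time_limited_scaleR[OF assms(1)] assms(2) real_sqrt_pow2[of "qip g g"] unfolding h_def
  by (simp_all add: qip_scaleR_left qip_scaleR_right conc_scaleR power_divide)

lemma conc_le_Lambda:
  assumes "g \<in> time_limited"
  shows "conc g g \<le> \<Lambda> * qip g g"
proof (cases "qip g g = 0")
  case True
  then show ?thesis using conc_le[OF assms] by simp
next
  case False
  then have pos: "qip g g > 0" using qip_nonneg[of g] by simp
  have "conc g g / qip g g \<le> \<Lambda>"
    unfolding \<Lambda>_def normalize_time_limited(2)[OF assms pos, symmetric]
    by (rule cSUP_upper[OF normalize_time_limited(1)[OF assms pos] bdd_conc])
  then show ?thesis using pos by (simp add: field_simps)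
qed

text \<open>The witness is the indicator of a square so small that differences of its points stay in
  the main lobe of both kernels; there its sinc image has positive real part.\<close>

lemma exists_conc_pos: "\<exists>g\<in>time_limited. conc g g > 0"
proof -
  \<comment> \<open>The bound by \<tau> keeps the square inside \<open>T\<close>; the bounds by
    \<open>1 / w1\<close> and \<open>1 / w2\<close> keep the kernel arguments within 2, which is
    less than \<open>pi\<close>.\<close>
  define r where "r = min \<tau> (min (1 / w1) (1 / w2))"
  have r: "r > 0" "r \<le> \<tau>" "r \<le> 1 / w1" "r \<le> 1 / w2"
    using tau_pos w1_pos w2_pos by (auto simp: r_def)
  define S where "S = rect r r"
  define g where "g = (\<lambda>p. indicator S p *\<^sub>R (1 :: quat))"
  have gm: "g \<in> borel_measurable borel" unfolding g_def S_def by simp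
  have "S \<subseteq> T" using r by (auto simp: S_def rect_def)
  have "g \<in> qL2"
  proof (rule qL2I[OF gm])
    show "integrable lborel (indicator S :: real \<times> real \<Rightarrow> real)"
      unfolding S_def by (intro integrable_indicator_bounded bounded_rect rect_borel)
  qed (simp add: g_def indicator_def)
  then have gV: "g \<in> time_limited" using \<open>S \<subseteq> T\<close> by (auto simp: time_limited_def g_def indicator_def)
  have "emeasure lborel S = ennreal ((2 * r)\<^sup>2)"
  proof -
    have "S = cbox (- r, - r) (r, r)"
      by (simp add: S_def rect_def cbox_Pair_eq)
    then show ?thesis using r(1)
      by (simp add: emeasure_lborel_cbox_eq Basis_prod_def prod.union_disjoint power2_eq_square)
  qed
  then have S_nonnull: "emeasure lborel S \<noteq> 0" using r(1) by simp
  have S_set: "S \<in> sets lborel" by (simp add: S_def)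
  have AE_False: "\<not> (AE p in lborel. p \<notin> S)"
    using S_nonnull S_set by (simp add: AE_iff_measurable[where N = S])
  have pos: "qre (K g p) > 0" if "p \<in> S" for p
  proof -
    define k where "k = (\<lambda>q. sinc2 w1 w2 (p - q) * indicator S q)"
    have kpos: "sinc2 w1 w2 (p - q) > 0" if "q \<in> S" for q
    proof -
      have "\<bar>w * a\<bar> < pi" if "\<bar>a\<bar> \<le> 2 * r" "w > 0" "r \<le> 1 / w" for w a
      proof -
        have "\<bar>w * a\<bar> \<le> w * (2 * r)" using that by (simp add: abs_mult)
        also have "\<dots> \<le> 2" using that by (simp add: field_simps)
        also have "\<dots> < pi" using pi_gt3 by simp
        finally show ?thesis .
      qed
      moreover have "\<bar>fst (p - q)\<bar> \<le> 2 * r" "\<bar>snd (p - q)\<bar> \<le> 2 * r"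
        using \<open>p \<in> S\<close> that by (auto simp: S_def rect_def)
      ultimately show ?thesis
        unfolding sinc2_def using r w1_pos w2_pos by (intro mult_pos_pos sinc_kernel_pos) auto
    qed
    have kI: "integrable lborel (\<lambda>q. k q *\<^sub>R (1::quat))"
      using sinc_op_integrable[OF time_limited_qL1[OF gV] w_nonneg, of p] by (simp add: k_def g_def)
    have kI': "integrable lborel k"
      using integrable_inner_left[OF kI, of 1] by simp
    have "K g p = (LINT q|lborel. k q *\<^sub>R 1)"
      by (simp add: sinc_op_eq g_def k_def)
    also have "\<dots> = (LINT q|lborel. k q) *\<^sub>R 1"
      using kI' by simp
    finally have K_eq: "qre (K g p) = (LINT q|lborel. k q)" by simp
    have k0: "k q \<ge> 0" for q using kpos[of q] by (cases "q \<in> S") (simp_all add: k_def)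
    have "(LINT q|lborel. k q) \<noteq> 0"
    proof
      assume "(LINT q|lborel. k q) = 0"
      then have "AE q in lborel. k q = 0"
        using integral_nonneg_eq_0_iff_AE[OF kI'] k0 by simp
      then have "AE q in lborel. q \<notin> S"
      proof eventually_elim
        case (elim q)
        then show ?case using kpos[of q] by (auto simp: k_def)
      qed
      then show False using AE_False by contradiction
    qed
    moreover have "(LINT q|lborel. k q) \<ge> 0" using k0 by simp
    ultimately show ?thesis unfolding K_eq by linarith
  qed
  have "conc g g \<noteq> 0"
  proof
    assume "conc g g = 0"
    then have "AE p in lborel. K g p = 0"
      using qip_self_eq_0_iff[OF K_qL2[OF gV]] by (simp add: conc_def)
    then have "AE p in lborel. p \<notin> S"
    proof eventually_elim
      case (elim p)
      then show ?case using pos[of p] by auto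
    qed
    then show False using AE_False by contradiction
  qed
  then show ?thesis using gV conc_nonneg[of g] by (intro bexI[of _ g]) auto
qed

lemma Lambda_pos: "\<Lambda> > 0"
proof -
  obtain g where g: "g \<in> time_limited" "conc g g > 0" using exists_conc_pos by auto
  have "0 < \<Lambda> * qip g g" using conc_le_Lambda[OF g(1)] g(2) by linarith
  then show ?thesis using qip_nonneg[of g] by (simp add: zero_less_mult_iff)
qed

text \<open>The form is semidefinite because \<Lambda> is an upper bound. If the defect of
  \<open>g\<close> is small, the form is therefore small against every fixed
  \<open>h\<close>.\<close>

lemma form_Cauchy_Schwarz:
  assumes "g \<in> time_limited" "h \<in> time_limited"
  shows "(\<Lambda> * qip g h - conc g h)\<^sup>2 \<le> (\<Lambda> * qip g g - conc g g) * (\<Lambda> * qip h h - conc h h)"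
proof (rule quadratic_nonneg_imp_discriminant)
  show "0 \<le> \<Lambda> * qip h h - conc h h" using conc_le_Lambda[OF assms(2)] by simp
  fix t :: real
  note L = time_limited_qL2[OF assms(1)] time_limited_qL2[OF assms(2)]
  have "qip (\<lambda>p. g p + t *\<^sub>R h p) (\<lambda>p. g p + t *\<^sub>R h p) = qip g g + 2 * t * qip g h + t\<^sup>2 * qip h h"
    using L by (simp add: qip_simps qip_commute[of h g] algebra_simps power2_eq_square)
  with conc_le_Lambda[OF time_limited_add_scaleR[OF assms, of t]]
  show "0 \<le> \<Lambda> * qip g g - conc g g + 2 * t * (\<Lambda> * qip g h - conc g h) + t\<^sup>2 * (\<Lambda> * qip h h - conc h h)"
    unfolding conc_add_scaleR[OF assms] by (simp add: algebra_simps)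
qed

section \<open>Attainment of the supremum\<close>

definition area :: real where
  "area = (LINT p|(lborel :: (real \<times> real) measure). indicator T p)"

text \<open>The sup and Lipschitz estimates for \<open>K\<close> involve the
  \<open>L\<^sup>1\<close> norm; on the bounded set \<open>T\<close> it is controlled uniformly over
  unit energy.\<close>

lemma norm_integral_time_limited_le:
  assumes "g \<in> time_limited" "qip g g = 1"
  shows "(LINT p|lborel. norm (g p)) \<le> area + 1"
proof -
  have I: "integrable lborel (indicator T :: real \<times> real \<Rightarrow> real)"
    by (intro integrable_indicator_bounded bounded_rect rect_borel)
  have "(LINT p|lborel. norm (g p)) \<le> (LINT p|lborel. indicator T p + (norm (g p))\<^sup>2)"
  proof (rule integral_mono)
    show "integrable lborel (\<lambda>p. norm (g p))"
      using time_limited_qL1[OF assms(1)] by (simp add: qL1_def)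
    show "integrable lborel (\<lambda>p. indicator T p + (norm (g p))\<^sup>2)"
      by (intro Bochner_Integration.integrable_add I qL2_integrable_square time_limited_qL2 assms)
    fix p
    show "norm (g p) \<le> indicator T p + (norm (g p))\<^sup>2"
      using time_limited_zero[OF assms(1), of p] by (cases "p \<in> T") (simp_all add: le_one_plus_square)
  qed
  also have "\<dots> = area + qip g g"
    unfolding area_def qip_self
    by (intro Bochner_Integration.integral_add I qL2_integrable_square time_limited_qL2 assms)
  finally show ?thesis using assms(2) by simp
qed

lemma maximizing_sequence:
  obtains g where "\<And>n. g n \<in> time_limited" "\<And>n. qip (g n) (g n) = 1" "\<And>n. \<Lambda> - 1 / real (Suc n) < conc (g n) (g n)"
proof -
  have "\<exists>g. g \<in> {g \<in> time_limited. qip g g = 1} \<and> \<Lambda> - 1 / real (Suc n) < conc g g" for n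
  proof -
    obtain g where g: "g \<in> time_limited" "conc g g > 0" using exists_conc_pos by auto
    then have "qip g g > 0" using conc_le[of g] by simp
    from normalize_time_limited(1)[OF g(1) this] have ne: "{g \<in> time_limited. qip g g = 1} \<noteq> {}" by auto
    have "\<Lambda> - 1 / real (Suc n) < \<Lambda>" by simp
    then have "\<exists>g\<in>{g \<in> time_limited. qip g g = 1}. \<Lambda> - 1 / real (Suc n) < conc g g"
      by (subst (asm) (2) \<Lambda>_def) (simp only: less_cSUP_iff[OF ne bdd_conc])
    then show ?thesis by (simp only: Bex_def)
  qed
  then have "\<exists>g. \<forall>n. g n \<in> {g \<in> time_limited. qip g g = 1} \<and> \<Lambda> - 1 / real (Suc n) < conc (g n) (g n)"
    by (intro choice allI)
  then obtain g where g: "\<forall>n. g n \<in> {g \<in> time_limited. qip g g = 1} \<and> \<Lambda> - 1 / real (Suc n) < conc (g n) (g n)"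
    by (rule exE)
  show thesis by (rule that[of g]) (use g in simp_all)
qed

text \<open>The images \<open>K (g n)\<close> share a bound \<open>M\<close> and a Lipschitz
  constant \<open>L\<close>, so a subsequence converges uniformly on the compact \<open>T\<close>,
  hence after \<open>cut\<close> in mean square.\<close>

lemma conc_compact:
  assumes g: "\<And>n. g n \<in> time_limited" "\<And>n. qip (g n) (g n) = 1"
  obtains \<psi> k where "\<psi> \<in> time_limited" "strict_mono (k :: nat \<Rightarrow> nat)" "qconv (\<lambda>n. cut (K (g (k n)))) \<psi>"
proof -
  define M where "M = w1 * w2 / pi\<^sup>2 * (area + 1)"
  define L where "L = (w1 * w2 * (w1 + w2) / pi\<^sup>2) * (area + 1)"
  have area0: "area \<ge> 0" by (simp add: area_def)
  have bd: "norm (K (g n) p) \<le> M" for n p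
    unfolding M_def
    by (rule order_trans[OF norm_sinc_op_le[OF time_limited_qL1[OF g(1)] w_nonneg] mult_left_mono[OF norm_integral_time_limited_le[OF g]]])
      (use w_nonneg in simp)
  have lip: "norm (K (g n) p - K (g n) p') \<le> L * norm (p - p')" for n p p'
  proof -
    have "norm (K (g n) p - K (g n) p')
        \<le> (w1 * w2 * (w1 + w2) / pi\<^sup>2) * norm (p - p') * (LINT q|lborel. norm (g n q))"
      by (rule sinc_op_lipschitz[OF time_limited_qL1[OF g(1)] w_nonneg])
    also have "\<dots> \<le> (w1 * w2 * (w1 + w2) / pi\<^sup>2) * norm (p - p') * (area + 1)"
      using w_nonneg by (intro mult_left_mono norm_integral_time_limited_le g) simp
    finally show ?thesis by (simp add: L_def mult_ac)
  qed
  have L: "L > 0" using w1_pos w2_pos area0 by (simp add: L_def)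
  obtain \<psi>0 k where \<psi>0: "continuous_on T \<psi>0" and k: "strict_mono (k :: nat \<Rightarrow> nat)"
    and unif: "\<And>e. 0 < e \<Longrightarrow> \<exists>N. \<forall>n x. n \<ge> N \<and> x \<in> T \<longrightarrow> norm (K (g (k n)) x - \<psi>0 x) < e"
  proof (rule Arzela_Ascoli[of T "\<lambda>n. K (g n)" M])
    show "compact T" by (rule compact_rect)
    show "\<exists>d. 0 < d \<and> (\<forall>n y. y \<in> T \<and> norm (x - y) < d \<longrightarrow> norm (K (g n) x - K (g n) y) < e)"
      if "0 < e" for x e
    proof (intro exI[of _ "e / L"] conjI allI impI)
      show "0 < e / L" using L that by simp
      fix n y assume "y \<in> T \<and> norm (x - y) < e / L"
      then have "L * norm (x - y) < e" using L by (simp add: field_simps)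
      then show "norm (K (g n) x - K (g n) y) < e" using lip[of n x y] by linarith
    qed
  qed (use bd that in auto)
  \<comment> \<open>The limit is controlled on \<open>T\<close> only, and is set to 0
    elsewhere.\<close>
  define \<psi> where "\<psi> = cut \<psi>0"
  have pw: "(\<lambda>n. K (g (k n)) p) \<longlonglongrightarrow> \<psi>0 p" if "p \<in> T" for p
    by (rule LIMSEQ_I) (use unif that in meson)
  have \<psi>_bd: "norm (\<psi> p) \<le> M" for p
  proof (cases "p \<in> T")
    case True
    have "norm (\<psi>0 p) \<le> M"
      by (rule LIMSEQ_le_const2[OF tendsto_norm[OF pw[OF True]]]) (use bd in auto)
    then show ?thesis using True by (simp add: \<psi>_def cut_def)
  next
    case False
    then show ?thesis using order_trans[OF norm_ge_zero bd[of 0 p]] by (simp add: \<psi>_def cut_def)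
  qed
  have wI: "integrable lborel (\<lambda>p::real \<times> real. C * indicator T p)" for C :: real
    by (intro integrable_mult_right integrable_indicator_bounded bounded_rect rect_borel)
  have \<psi>m: "\<psi> \<in> borel_measurable borel"
    unfolding \<psi>_def cut_def by (rule borel_measurable_continuous_on_indicator[OF rect_borel \<psi>0])
  have "\<psi> \<in> qL2"
  proof (rule qL2I[OF \<psi>m wI[of "M\<^sup>2"]])
    show "(norm (\<psi> p))\<^sup>2 \<le> M\<^sup>2 * indicator T p" for p
      using power_mono[OF \<psi>_bd[of p], of 2] by (cases "p \<in> T") (simp_all add: \<psi>_def cut_def)
  qed
  then have \<psi>V: "\<psi> \<in> time_limited" by (simp add: time_limited_def \<psi>_def cut_def)
  have "qconv (\<lambda>n. cut (K (g (k n)))) \<psi>"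
  proof (rule qconv_dominated[OF time_limited_qL2[OF time_limited_cut[OF K_qL2[OF g(1)]]] \<open>\<psi> \<in> qL2\<close> wI[of "(2 * M)\<^sup>2"]])
    show "AE p in lborel. (\<lambda>n. cut (K (g (k n))) p) \<longlonglongrightarrow> \<psi> p"
    proof (rule AE_I2)
      show "(\<lambda>n. cut (K (g (k n))) p) \<longlonglongrightarrow> \<psi> p" for p
        using pw[of p] by (cases "p \<in> T") (simp_all add: cut_def \<psi>_def)
    qed
    have "(norm (cut (K (g (k n))) p - \<psi> p))\<^sup>2 \<le> (2 * M)\<^sup>2 * indicator T p" for n p
    proof (cases "p \<in> T")
      case True
      have "norm (K (g (k n)) p - \<psi> p) \<le> 2 * M"
        unfolding mult_2 by (intro norm_triangle_le_diff add_mono bd \<psi>_bd)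
      from power_mono[OF this, of 2] show ?thesis using True by (simp add: cut_def)
    next
      case False
      then show ?thesis by (simp add: \<psi>_def cut_def)
    qed
    then show "AE p in lborel. (norm (cut (K (g (k n))) p - \<psi> p))\<^sup>2 \<le> (2 * M)\<^sup>2 * indicator T p" for n
      by (intro AE_I2)
  qed
  with \<psi>V k show thesis by (rule that)
qed

text \<open>The defect of a maximizing sequence tends to 0, so by the Cauchy-Schwarz inequality for the
  form \<open>\<Lambda> \<langle>g, h\<rangle> - conc g h\<close> it is weakly an approximate eigenvector; compactness turns this into
  an eigenvector.\<close>

lemma Lambda_attained:
  obtains \<psi> where "\<psi> \<in> time_limited" "qip \<psi> \<psi> > 0" "AE p in lborel. cut (K \<psi>) p = \<Lambda> *\<^sub>R \<psi> p"
proof -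
  obtain g where g: "\<And>n. g n \<in> time_limited" "\<And>n. qip (g n) (g n) = 1"
    and gL: "\<And>n. \<Lambda> - 1 / real (Suc n) < conc (g n) (g n)"
    by (rule maximizing_sequence) (rule that)
  obtain \<psi> k where \<psi>: "\<psi> \<in> time_limited" and k: "strict_mono (k :: nat \<Rightarrow> nat)"
    and conv: "qconv (\<lambda>n. cut (K (g (k n)))) \<psi>"
    using g by (rule conc_compact) (rule that)
  define G where "G = (\<lambda>n. g (k n))"
  have G: "G n \<in> time_limited" "qip (G n) (G n) = 1" for n by (simp_all add: G_def g)
  have KG: "cut (K (G n)) \<in> qL2" for n by (rule time_limited_qL2[OF time_limited_cut[OF K_qL2[OF G(1)]]])
  have conv: "qconv (\<lambda>n. cut (K (G n))) \<psi>" using conv by (simp add: G_def)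
  note \<psi>L = time_limited_qL2[OF \<psi>]
  have defect: "(\<lambda>n. \<Lambda> - conc (G n) (G n)) \<longlonglongrightarrow> 0"
  proof (rule tendsto_sandwich[OF _ _ tendsto_const])
    show "\<forall>\<^sub>F n in sequentially. 0 \<le> \<Lambda> - conc (G n) (G n)"
      using conc_le_Lambda[OF G(1)] G(2) by simp
    show "\<forall>\<^sub>F n in sequentially. \<Lambda> - conc (G n) (G n) \<le> inverse (real (Suc n))"
    proof (intro always_eventually allI)
      fix n
      have "\<Lambda> - conc (G n) (G n) \<le> 1 / real (Suc (k n))"
        using gL[of "k n"] by (simp add: G_def)
      also have "\<dots> \<le> 1 / real (Suc n)"
        using seq_suble[OF k, of n] by (intro divide_left_mono) auto
      finally show "\<Lambda> - conc (G n) (G n) \<le> inverse (real (Suc n))" by (simp add: inverse_eq_divide)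
    qed
  qed (rule LIMSEQ_inverse_real_of_nat)
  have conc_lim: "(\<lambda>n. conc (G n) h) \<longlonglongrightarrow> qip \<psi> h" if "h \<in> time_limited" for h
  proof -
    have "(\<lambda>n. qip (cut (K (G n))) h) \<longlonglongrightarrow> qip \<psi> h"
      by (rule qip_tendsto[OF KG \<psi>L conv time_limited_qL2[OF that] time_limited_qL2[OF that] qconv_const])
    then show ?thesis by (simp add: conc_eq G that qip_cut_left)
  qed
  \<comment> \<open>The sequence \<open>G n\<close> itself is not known to converge, but
    \<open>\<Lambda>\<close> times it converges weakly to \<open>\<psi>\<close>, since its pairing
    with \<open>h\<close> differs from \<open>conc (G n) h\<close> by a null sequence.\<close>
  have weak: "(\<lambda>n. \<Lambda> * qip (G n) h) \<longlonglongrightarrow> qip \<psi> h" if "h \<in> time_limited" for h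
  proof -
    have "(\<lambda>n. (\<Lambda> * qip (G n) h - conc (G n) h)\<^sup>2) \<longlonglongrightarrow> 0"
    proof (rule tendsto_sandwich[OF _ _ tendsto_const])
      show "\<forall>\<^sub>F n in sequentially. (\<Lambda> * qip (G n) h - conc (G n) h)\<^sup>2
          \<le> (\<Lambda> - conc (G n) (G n)) * (\<Lambda> * qip h h - conc h h)"
        using form_Cauchy_Schwarz[OF G(1) that] G(2) by simp
      show "(\<lambda>n. (\<Lambda> - conc (G n) (G n)) * (\<Lambda> * qip h h - conc h h)) \<longlonglongrightarrow> 0"
        using tendsto_mult_right[OF defect, of "\<Lambda> * qip h h - conc h h"] by simp
    qed simp
    then have "(\<lambda>n. \<Lambda> * qip (G n) h - conc (G n) h) \<longlonglongrightarrow> 0" by simp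
    from tendsto_add[OF this conc_lim[OF that]] show ?thesis by simp
  qed
  have conc_psi: "conc \<psi> h = \<Lambda> * qip \<psi> h" if h: "h \<in> time_limited" for h
  proof -
    \<comment> \<open>evaluate the limit of \<open>\<Lambda> \<langle>G n, K h\<rangle>\<close> in two ways\<close>
    have "(\<lambda>n. \<Lambda> * qip (G n) (cut (K h))) \<longlonglongrightarrow> qip \<psi> (cut (K h))"
      by (rule weak[OF time_limited_cut[OF K_qL2[OF h]]])
    then have "(\<lambda>n. \<Lambda> * conc (G n) h) \<longlonglongrightarrow> conc \<psi> h"
      by (simp add: qip_cut G \<psi> conc_commute[of _ h] conc_eq h qip_commute[of _ "K h"])
    moreover have "(\<lambda>n. \<Lambda> * conc (G n) h) \<longlonglongrightarrow> \<Lambda> * qip \<psi> h"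
      by (intro tendsto_mult_left conc_lim h)
    ultimately show ?thesis by (rule LIMSEQ_unique)
  qed
  show thesis
  proof (rule that[OF \<psi>])
    \<comment> \<open>The residual is itself time-limited and may be used as the test function in
      \<open>conc_psi\<close>, which makes its energy vanish.\<close>
    define d where "d = (\<lambda>p. cut (K \<psi>) p + (- \<Lambda>) *\<^sub>R \<psi> p)"
    have dV: "d \<in> time_limited" unfolding d_def by (intro time_limited_add_scaleR time_limited_cut K_qL2 \<psi>)
    have "qip d d = qip (cut (K \<psi>)) d - \<Lambda> * qip \<psi> d"
    proof -
      have "qip d d = qip (\<lambda>p. cut (K \<psi>) p + (- \<Lambda>) *\<^sub>R \<psi> p) d" by (simp add: d_def)
      also have "\<dots> = qip (cut (K \<psi>)) d - \<Lambda> * qip \<psi> d"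
        using time_limited_qL2[OF dV] \<psi>L time_limited_qL2[OF time_limited_cut[OF K_qL2[OF \<psi>]]]
        by (subst qip_add_left) (auto intro: qL2_scaleR simp: qip_scaleR_left simp del: scaleR_minus_left)
      finally show ?thesis .
    qed
    also have "\<dots> = 0"
      using conc_psi[OF dV] by (simp add: qip_cut_left dV conc_eq \<psi>)
    finally have "AE p in lborel. d p = 0"
      using qip_self_eq_0_iff[OF time_limited_qL2[OF dV]] by simp
    then show "AE p in lborel. cut (K \<psi>) p = \<Lambda> *\<^sub>R \<psi> p"
      by eventually_elim (simp add: d_def)
    \<comment> \<open>The limit is not zero: as \<open>G n\<close> has unit energy, the energy of
      \<open>cut (K (G n))\<close> is at least the square of \<open>conc (G n) (G n)\<close>, which
      tends to \<open>\<Lambda>\<^sup>2\<close>.\<close>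
    have "(\<lambda>n. (conc (G n) (G n))\<^sup>2) \<longlonglongrightarrow> \<Lambda>\<^sup>2"
      using tendsto_power[OF tendsto_diff[OF tendsto_const defect, of \<Lambda>], of 2] by simp
    moreover have "(\<lambda>n. qip (cut (K (G n))) (cut (K (G n)))) \<longlonglongrightarrow> qip \<psi> \<psi>"
      by (rule qip_tendsto[OF KG \<psi>L conv KG \<psi>L conv])
    moreover have "(conc (G n) (G n))\<^sup>2 \<le> qip (cut (K (G n))) (cut (K (G n)))" for n
      using qip_Cauchy_Schwarz[OF KG time_limited_qL2[OF G(1)], of n n] G(2)[of n]
      by (simp add: conc_eq G qip_cut_left)
    ultimately have "\<Lambda>\<^sup>2 \<le> qip \<psi> \<psi>"
      by (intro LIMSEQ_le) auto
    then show "qip \<psi> \<psi> > 0" using Lambda_pos by (meson less_le_trans zero_less_power)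
  qed
qed

section \<open>Eigenfunctions and extremal signals\<close>

lemma K_cong_AE:
  assumes "f \<in> qL1" "g \<in> qL1" "AE p in lborel. f p = g p"
  shows "K f = K g"
proof
  fix p
  show "K f p = K g p"
    unfolding sinc_op_eq
  proof (rule integral_cong_AE)
    show "AE q in lborel. sinc2 w1 w2 (p - q) *\<^sub>R f q = sinc2 w1 w2 (p - q) *\<^sub>R g q"
      using assms(3) by eventually_elim simp
  qed (use assms(1,2) in measurable)
qed

lemma eigenfunction_cut_iff:
  "eigenfunction T w1 w2 \<mu> f \<longleftrightarrow> f \<in> qL2 \<and> qip f f > 0 \<and> (AE p in lborel. K (cut f) p = \<mu> *\<^sub>R f p)"
  unfolding eigenfunction_iff cut_def using nonzero_iff_qip by blast

text \<open>The maximizer \<open>\<psi>\<close> solves the equation only on \<open>T\<close>,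
  whereas an eigenfunction must solve it on the plane. Its extension \<open>K \<psi>\<close> does:
  \<open>cut (K \<psi>)\<close> is \<open>\<Lambda>\<close> times \<open>\<psi>\<close>, and
  applying \<open>K\<close> once more gives the claim.\<close>

lemma Lambda_eigenvalue: "\<Lambda> \<in> eigenvalues T w1 w2"
proof -
  obtain \<psi> where \<psi>: "\<psi> \<in> time_limited" "qip \<psi> \<psi> > 0" and ae: "AE p in lborel. cut (K \<psi>) p = \<Lambda> *\<^sub>R \<psi> p"
    by (rule Lambda_attained) (rule that)
  note c = time_limited_cut[OF K_qL2[OF \<psi>(1)]] and s = time_limited_scaleR[OF \<psi>(1), of \<Lambda>]
  have "K (cut (K \<psi>)) = (\<lambda>p. \<Lambda> *\<^sub>R K \<psi> p)"
    using K_cong_AE[OF time_limited_qL1[OF c] time_limited_qL1[OF s] ae] by (simp add: sinc_op_scaleR)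
  moreover have "qip (K \<psi>) (K \<psi>) > 0"
  proof -
    have "qip (K \<psi>) \<psi> = qip (cut (K \<psi>)) \<psi>" by (simp add: qip_cut_left \<psi>)
    also have "\<dots> = qip (\<lambda>p. \<Lambda> *\<^sub>R \<psi> p) \<psi>"
      by (rule qip_cong_AE[OF ae]) (simp_all add: time_limited_qL2 c s \<psi>)
    also have "\<dots> > 0" using Lambda_pos \<psi>(2) by (simp add: qip_scaleR_left)
    finally show ?thesis using conc_eq[OF \<psi>(1) \<psi>(1)] by (simp add: conc_def)
  qed
  ultimately have "eigenfunction T w1 w2 \<Lambda> (K \<psi>)"
    unfolding eigenfunction_cut_iff using K_qL2[OF \<psi>(1)] by simp
  then show ?thesis by (auto simp: eigenvalues_def)
qed

lemma energy_ratio_cut: "energy_ratio T f = qip (cut f) (cut f) / qip f f"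
  by (simp add: energy_ratio_eq cut_def)

lemma qip_cut_bandlimited:
  assumes "f \<in> bandlimited (rect w1 w2)"
  shows "qip (K (cut f)) f = qip (cut f) (cut f)"
  using time_limited_cut[OF bandlimited_qL2[OF assms]] by (simp add: qip_K[OF assms] qip_cut)

text \<open>The energy of \<open>cut f\<close> equals \<open>qip (K (cut f)) f\<close>.
  Cauchy-Schwarz bounds its square by the concentration of \<open>cut f\<close> times the energy of
  \<open>f\<close>, and one factor cancels.\<close>

lemma energy_ratio_le:
  assumes f: "f \<in> bandlimited (rect w1 w2)" and pos: "qip f f > 0"
  shows "energy_ratio T f \<le> \<Lambda>"
proof -
  note V = time_limited_cut[OF bandlimited_qL2[OF f]]
  let ?e = "qip (cut f) (cut f)"
  have "?e\<^sup>2 \<le> qip (K (cut f)) (K (cut f)) * qip f f"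
    using qip_Cauchy_Schwarz[OF K_qL2[OF V] bandlimited_qL2[OF f]] by (simp add: qip_cut_bandlimited f)
  also have "\<dots> \<le> (\<Lambda> * ?e) * qip f f"
    using conc_le_Lambda[OF V] pos by (intro mult_right_mono) (auto simp: conc_def)
  finally have "?e * ?e \<le> ?e * (\<Lambda> * qip f f)" by (simp add: power2_eq_square mult_ac)
  then have "?e \<le> \<Lambda> * qip f f"
    using qip_nonneg[of "cut f"] Lambda_pos pos by (cases "?e = 0") auto
  then show ?thesis using pos by (simp add: energy_ratio_cut divide_le_eq)
qed

text \<open>Dividing by \<mu> exhibits \<open>f\<close>, up to a null set, as a sinc image; pairing
  the equation with \<open>f\<close> then reads off the ratio.\<close>

lemma eigenfunction_bandlimited:
  assumes e: "eigenfunction T w1 w2 \<mu> f" and "\<mu> \<noteq> 0"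
  shows "f \<in> bandlimited (rect w1 w2)" "energy_ratio T f = \<mu>"
proof -
  from e have f: "f \<in> qL2" "qip f f > 0" and ae: "AE p in lborel. K (cut f) p = \<mu> *\<^sub>R f p"
    by (simp_all add: eigenfunction_cut_iff)
  note V = time_limited_cut[OF f(1)]
  have "AE p in lborel. f p = K (\<lambda>p. (1 / \<mu>) *\<^sub>R cut f p) p"
    using ae by eventually_elim (simp add: sinc_op_scaleR \<open>\<mu> \<noteq> 0\<close>)
  then show b: "f \<in> bandlimited (rect w1 w2)"
    by (rule bandlimited_cong_AE[OF K_bandlimited[OF time_limited_scaleR[OF V]] f(1)])
  have "qip (cut f) (cut f) = qip (K (cut f)) f"
    by (simp add: qip_cut_bandlimited b)
  also have "\<dots> = qip (\<lambda>p. \<mu> *\<^sub>R f p) f"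
    by (rule qip_cong_AE[OF ae]) (simp_all add: f K_qL2 V qL2_scaleR)
  also have "\<dots> = \<mu> * qip f f" by (rule qip_scaleR_left)
  finally show "energy_ratio T f = \<mu>" using f(2) by (simp add: energy_ratio_cut)
qed

lemma energy_ratio_max_eigenfunction:
  assumes f: "f \<in> bandlimited (rect w1 w2)" and pos: "qip f f > 0" and eq: "energy_ratio T f = \<Lambda>"
  shows "eigenfunction T w1 w2 \<Lambda> f"
proof -
  note fL = bandlimited_qL2[OF f]
  note V = time_limited_cut[OF fL]
  let ?d = "\<lambda>p. K (cut f) p - \<Lambda> *\<^sub>R f p"
  have e: "qip (cut f) (cut f) = \<Lambda> * qip f f"
    using eq pos by (simp add: energy_ratio_cut field_simps)
  have "qip ?d ?d = conc (cut f) (cut f) - 2 * \<Lambda> * qip (K (cut f)) f + \<Lambda>\<^sup>2 * qip f f"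
    using K_qL2[OF V] fL
    by (simp add: conc_def qip_simps qip_commute[of f "K (cut f)"] algebra_simps power2_eq_square)
  \<comment> \<open>The only inequality is the bound on \<open>conc\<close>; with the assumed ratio
    the remaining terms cancel, which forces the residual to vanish.\<close>
  also have "\<dots> \<le> \<Lambda> * qip (cut f) (cut f) - 2 * \<Lambda> * qip (cut f) (cut f) + \<Lambda>\<^sup>2 * qip f f"
    using conc_le_Lambda[OF V] by (simp add: qip_cut_bandlimited f)
  also have "\<dots> = 0" unfolding e by (simp add: power2_eq_square)
  finally have "qip ?d ?d = 0" using qip_nonneg[of ?d] by linarith
  then have "AE p in lborel. ?d p = 0"
    using qip_self_eq_0_iff[of ?d] K_qL2[OF V] fL by (simp add: qL2_diff qL2_scaleR)
  then have "AE p in lborel. K (cut f) p = \<Lambda> *\<^sub>R f p" by eventually_elim simp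
  then show ?thesis by (simp add: eigenfunction_cut_iff fL pos)
qed

text \<open>Since \<Lambda> is an eigenvalue, it is at most \<mu>; so \<mu> is positive and its
  eigenfunctions are bandlimited with ratio \<mu>, which in turn is at most \<Lambda>. Hence the two
  agree.\<close>

theorem max_energy_ratio:
  assumes max: "is_maximum (eigenvalues T w1 w2) \<mu>"
  shows "is_maximum (energy_ratio T ` {f \<in> bandlimited (rect w1 w2). nonzero f}) \<mu>"
    and "eigenfunction T w1 w2 \<mu> f \<longleftrightarrow>
      f \<in> bandlimited (rect w1 w2) \<and> nonzero f \<and> energy_ratio T f = \<mu>"
proof -
  have nz: "nonzero f \<longleftrightarrow> qip f f > 0" if "f \<in> bandlimited (rect w1 w2)" for f
    by (rule nonzero_iff_qip[OF bandlimited_qL2[OF that]])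
  have le: "\<Lambda> \<le> \<mu>" using max Lambda_eigenvalue by (auto simp: is_maximum_def)
  then have "\<mu> \<noteq> 0" using Lambda_pos by simp
  obtain f0 where f0: "eigenfunction T w1 w2 \<mu> f0"
    using max by (auto simp: is_maximum_def eigenvalues_def)
  note b0 = eigenfunction_bandlimited[OF f0 \<open>\<mu> \<noteq> 0\<close>]
  have n0: "nonzero f0" using f0 by (simp add: eigenfunction_def)
  have "\<mu> = \<Lambda>" using energy_ratio_le[OF b0(1)] n0 nz[OF b0(1)] b0(2) le by simp
  show "is_maximum (energy_ratio T ` {f \<in> bandlimited (rect w1 w2). nonzero f}) \<mu>"
    unfolding is_maximum_def
  proof (intro conjI ballI)
    show "\<mu> \<in> energy_ratio T ` {f \<in> bandlimited (rect w1 w2). nonzero f}"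
      by (rule image_eqI[of _ _ f0]) (use b0 n0 in simp_all)
    fix x assume "x \<in> energy_ratio T ` {f \<in> bandlimited (rect w1 w2). nonzero f}"
    then obtain f where "f \<in> bandlimited (rect w1 w2)" "nonzero f" "x = energy_ratio T f" by auto
    then show "x \<le> \<mu>" using energy_ratio_le[of f] nz[of f] \<open>\<mu> = \<Lambda>\<close> by simp
  qed
  show "eigenfunction T w1 w2 \<mu> f \<longleftrightarrow>
      f \<in> bandlimited (rect w1 w2) \<and> nonzero f \<and> energy_ratio T f = \<mu>"
  proof
    assume f: "eigenfunction T w1 w2 \<mu> f"
    then have "nonzero f" by (simp add: eigenfunction_def)
    with eigenfunction_bandlimited[OF f \<open>\<mu> \<noteq> 0\<close>]
    show "f \<in> bandlimited (rect w1 w2) \<and> nonzero f \<and> energy_ratio T f = \<mu>" by simp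
  next
    assume f: "f \<in> bandlimited (rect w1 w2) \<and> nonzero f \<and> energy_ratio T f = \<mu>"
    then show "eigenfunction T w1 w2 \<mu> f"
      using energy_ratio_max_eigenfunction[of f] nz[of f] \<open>\<mu> = \<Lambda>\<close> by simp
  qed
qed

end

text \<open>The kernel being real, an eigenfunction multiplied by a nonzero constant quaternion is
  again one, so there is no single extremal function; the last claim is an equivalence between
  eigenfunctions for \<open>\<mu>max\<close> and maximizers.\<close>

theorem theorem5p1:
  fixes \<tau> \<sigma> a1 b1 c1 d1 a2 b2 c2 d2 \<mu>max :: real
  assumes "\<tau> > 0" and "\<sigma> > 0"
    and "a1 * d1 - b1 * c1 = 1" and "b1 > 0"
    and "a2 * d2 - b2 * c2 = 1" and "b2 > 0"
    and "is_maximum (eigenvalues (rect \<tau> \<tau>) (\<sigma> / b1) (\<sigma> / b2)) \<mu>max"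
  shows "is_maximum
           (energy_ratio (rect \<tau> \<tau>) ` {f \<in> bandlimited (rect (\<sigma> / b1) (\<sigma> / b2)). nonzero f}) \<mu>max
       \<and> (\<forall>f. eigenfunction (rect \<tau> \<tau>) (\<sigma> / b1) (\<sigma> / b2) \<mu>max f \<longleftrightarrow>
            f \<in> bandlimited (rect (\<sigma> / b1) (\<sigma> / b2)) \<and> nonzero f \<and>
            energy_ratio (rect \<tau> \<tau>) f = \<mu>max)"
proof -
  interpret concentration \<tau> "\<sigma> / b1" "\<sigma> / b2"
    by unfold_locales (use assms in simp_all)
  show ?thesis using max_energy_ratio[OF assms(7)] by simp
qed

end
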